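(* Let $(E,d)$ be a Polish metric space, let $x_0\in E$, let $C>0$, let $\mu\in\mathcal P(E)$ satisfy a $\mathbf T_1(C)$ inequality, and let $L_n=\frac1n\sum_{i=1}^n\delta_{X_i}$ where $X_1,\dots,X_n$ are i.i.d. with law $\mu$. Let $t>0$. Let $a>0$ be such that $\int e^{a\,d(x_0,x)}\,\mu(dx)\le 2$, and choose a compact set $K\subset E$ with $x_0\in K$ and $$\mu(K^c)\le\left[\frac{32}{at}\log\frac{32}{at}-\frac{32}{at}+1\right]^{-1}.$$ Let $\mathcal F_K$ be the set of $1$-Lipschitz functions $f:K\to\mathbb R$ with $f(x_0)=0$, endowed with the uniform distance, and let $\mathcal C_t=\mathcal N(\mathcal F_K,t/8)$. Then $$\mathbb P\big(W_1(L_n,\mu)\ge t\big)\le\mathcal C_t\,\exp\left(-\frac{1}{8C}\,n t^2\right).$$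
   Context: $\mathcal P(E)$ is the set of Borel probability measures on $E$ and $\mathcal P_1(E)$ those with finite first moment. $W_1(\mu,\nu)=\inf_\pi\int d(x,y)\,\pi(dx,dy)$ over couplings $\pi$ of $\mu,\nu$. The relative entropy is $H(\nu|\mu)=\int\log\frac{d\nu}{d\mu}\,d\nu$ if $\nu\ll\mu$ and $+\infty$ otherwise. $\mu\in\mathcal P_1(E)$ satisfies $\mathbf T_1(C)$ if $W_1(\mu,\nu)\le\sqrt{C\,H(\nu|\mu)}$ for all $\nu\in\mathcal P_1(E)$. For a totally bounded metric space $A$ and $\delta>0$, the covering number $\mathcal N(A,\delta)$ is the minimal number of (closed) balls of radius $\delta$, centered in $A$, needed to cover $A$. If the bracket in the condition on $\mu(K^c)$ vanishes, its inverse is read as $+\infty$. *)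

theory Defs
  imports "HOL-Probability.Probability"
begin

definition prob_measures :: "'a::topological_space measure set"
  where "prob_measures = {\<mu>. prob_space \<mu> \<and> sets \<mu> = sets borel}"

definition prob_measures_1 :: "'a::metric_space measure set"
  where "prob_measures_1 = {\<mu> \<in> prob_measures. \<exists>x0. integrable \<mu> (\<lambda>x. dist x0 x)}"

definition couplings :: "'a::topological_space measure \<Rightarrow> 'a measure \<Rightarrow> ('a \<times> 'a) measure set"
  where "couplings \<mu> \<nu> =
    {\<pi> \<in> prob_measures. distr \<pi> borel fst = \<mu> \<and> distr \<pi> borel snd = \<nu>}"

definition W1 :: "'a::metric_space measure \<Rightarrow> 'a measure \<Rightarrow> ennreal"
  where "W1 \<mu> \<nu> = (INF \<pi>\<in>couplings \<mu> \<nu>. \<integral>\<^sup>+ (x, y). ennreal (dist x y) \<partial>\<pi>)"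

text \<open>
  \<^term>\<open>relative_entropy \<nu> \<mu>\<close> is the extended real number \<open>H(\<nu>|\<mu>)\<close>. The library's
  \<^const>\<open>KL_divergence\<close> takes its arguments in the opposite order. It is a Bochner integral, so it is
  \<open>0\<close> when \<open>log d\<nu>/d\<mu>\<close> is not \<open>\<nu>\<close>-integrable. For probability measures \<open>\<nu> \<lless> \<mu>\<close> the negative part
  of \<open>log d\<nu>/d\<mu>\<close> always is \<open>\<nu>\<close>-integrable, hence in that case \<open>\<integral> log d\<nu>/d\<mu> d\<nu> = \<infinity>\<close>.
\<close>

definition relative_entropy :: "'a measure \<Rightarrow> 'a measure \<Rightarrow> ereal"
  where "relative_entropy \<nu> \<mu> =
    (if absolutely_continuous \<mu> \<nu> \<and> integrable \<nu> (entropy_density (exp 1) \<mu> \<nu>)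
     then ereal (KL_divergence (exp 1) \<mu> \<nu>) else \<infinity>)"

definition ereal_sqrt :: "ereal \<Rightarrow> ennreal"
  where "ereal_sqrt x = (if x = \<infinity> then \<infinity> else ennreal (sqrt (real_of_ereal x)))"

definition T1 :: "real \<Rightarrow> 'a::metric_space measure \<Rightarrow> bool"
  where "T1 C \<mu> \<longleftrightarrow> \<mu> \<in> prob_measures_1 \<and>
    (\<forall>\<nu>\<in>prob_measures_1. W1 \<mu> \<nu> \<le> ereal_sqrt (ereal C * relative_entropy \<nu> \<mu>))"

definition empirical_measure :: "nat \<Rightarrow> (nat \<Rightarrow> 'a::topological_space) \<Rightarrow> 'a measure"
  where "empirical_measure n x =
    measure_of UNIV (sets borel)
      (\<lambda>A. ennreal (1 / real n) * (\<Sum>i=1..n. emeasure (return borel (x i)) A))"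

text \<open>
  The metric space of \<open>1\<close>-Lipschitz functions \<open>f : K \<rightarrow> \<real>\<close> with \<open>f x0 = 0\<close> under the uniform distance.
  As usual for \<^const>\<open>funspace\<close>, functions on \<open>K\<close> are represented by total functions with
  value \<^const>\<open>undefined\<close> outside \<open>K\<close>. \<^const>\<open>funspace\<close> admits only bounded functions, which is no
  restriction here as long as \<open>K\<close> is compact.
\<close>

definition lipschitz_space :: "'a::metric_space set \<Rightarrow> 'a \<Rightarrow> ('a \<Rightarrow> real) metric"
  where "lipschitz_space K x0 =
    submetric (funspace K euclidean_metric) {f. 1-lipschitz_on K f \<and> f x0 = 0}"

text \<open>Only meaningful if \<open>A\<close> is totally bounded, otherwise there may be no finite cover.\<close>

definition covering_number :: "'a metric \<Rightarrow> real \<Rightarrow> nat"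
  where "covering_number A \<delta> =
    (LEAST N. \<exists>S. S \<subseteq> mspace A \<and> finite S \<and> card S = N \<and>
                  mspace A \<subseteq> (\<Union>c\<in>S. mcball_of A c \<delta>))"

lemma sets_empirical_measure [simp]: "sets (empirical_measure n x) = sets borel"
  unfolding empirical_measure_def
  by (metis sets.sets_measure_of_eq space_borel)

lemma emeasure_empirical_measure:
  assumes "A \<in> sets borel"
  shows "emeasure (empirical_measure n x) A =
    ennreal (1 / real n) * (\<Sum>i=1..n. emeasure (return borel (x i)) A)"
proof (rule emeasure_measure_of[OF empirical_measure_def])
  show "countably_additive (sets (empirical_measure n x))
     (\<lambda>A. ennreal (1 / real n) * (\<Sum>i=1..n. emeasure (return borel (x i)) A))"
  proof (rule countably_additiveI)
    fix B :: "nat \<Rightarrow> 'a set"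
    assume B: "range B \<subseteq> sets (empirical_measure n x)" "disjoint_family B"
    have "(\<Sum>j. emeasure (return borel (x i)) (B j)) = emeasure (return borel (x i)) (\<Union>(range B))"
      for i
      using B by (intro suminf_emeasure) auto
    then show "(\<Sum>j. ennreal (1 / real n) * (\<Sum>i=1..n. emeasure (return borel (x i)) (B j))) =
        ennreal (1 / real n) * (\<Sum>i=1..n. emeasure (return borel (x i)) (\<Union>(range B)))"
      by (simp add: suminf_sum)
  qed
qed (use assms in \<open>auto simp: positive_def\<close>)

lemma mspace_lipschitz_space:
  assumes "compact K"
  shows "mspace (lipschitz_space K x0) =
    {f. f \<in> extensional K \<and> 1-lipschitz_on K f \<and> f x0 = 0}"
proof -
  have "bounded (f ` K)" if "1-lipschitz_on K f" for f :: "'a \<Rightarrow> real"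
    using assms that by (intro compact_imp_bounded compact_continuous_image lipschitz_on_continuous_on)
  then show ?thesis
    by (auto simp: lipschitz_space_def Met_TC.fspace_def)
qed

end

theory Submission
  imports Defs
begin

text \<open>
  The duality \<open>W1 L \<mu> \<le> sup (\<integral> g d\<mu> - \<integral> g dL)\<close> over \<open>1\<close>-Lipschitz \<open>g\<close>, for \<open>L\<close> the uniform
  distribution on \<open>x 1, \<dots>, x n\<close>, comes from entropic regularisation. Maximise
  \<open>h \<mapsto> (\<Sum>i. h i) / n - \<epsilon> \<integral> ln (\<Sum>i. exp ((h i - d(x i, y)) / \<epsilon>)) \<mu>(dy)\<close>. At a maximiser the
  first-order condition says that the softmax weights integrate to \<open>1 / n\<close>, so they define an exact
  coupling of \<open>L\<close> and \<open>\<mu>\<close>; its cost exceeds the maximum by at most \<open>\<epsilon> ln n\<close>, and the soft minimum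
  of the \<open>d(x i, y) - h i\<close> is \<open>1\<close>-Lipschitz.

  If \<open>W1 L \<mu> \<ge> t\<close>, an almost optimal \<open>g\<close> is \<open>t/8\<close>-close on \<open>K\<close> to one of the \<open>f\<close> in a
  minimal cover. The least \<open>1\<close>-Lipschitz extension \<open>F\<close> of \<open>f\<close> satisfies \<open>F \<le> g + t/8\<close> everywhere, so
  no tail term of the random measure \<open>L\<close> appears, while \<open>g - F \<le> t/8 + 2 d(x0, _)\<close> off \<open>K\<close> costs only
  the deterministic tail \<open>2 \<integral>\<^bsub>-K\<^esub> d(x0, _) d\<mu> \<le> t/8\<close>, by Young's inequality for \<open>s ln s - s + 1\<close> and
  \<open>exp y - 1\<close>. Hence \<open>\<integral> F d\<mu> - \<integral> F dL \<ge> t/2\<close>, which for each \<open>f\<close> has probability at most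
  \<open>exp (- n t\<^sup>2 / (4 C))\<close> by the Chernoff bound, since \<open>T1\<close> applied to the tilted measures
  \<open>exp (l f) \<mu>\<close> bounds the Laplace transform of Lipschitz functions (Bobkov--Goetze).
\<close>

subsection \<open>Entropic duality for semi-discrete transport\<close>

text \<open>The box is taken in the full function space, where Tychonoff's theorem makes it compact.
  The Lipschitz bound involves finitely many coordinates, so \<open>F\<close> is continuous for the
  product topology.\<close>

lemma continuous_attains_sup_box:
  fixes F :: "('i \<Rightarrow> real) \<Rightarrow> real" and r :: "'i \<Rightarrow> real"
  assumes "finite I" and nonneg: "\<And>i. r i \<ge> 0"
    and lip: "\<And>h h'. \<bar>F h - F h'\<bar> \<le> L * (\<Sum>i\<in>I. \<bar>h i - h' i\<bar>)"
  shows "\<exists>h. \<forall>h'. (\<forall>i. - r i \<le> h' i \<and> h' i \<le> 0) \<longrightarrow> F h' \<le> F h"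
proof -
  let ?B = "PiE UNIV (\<lambda>i. {- r i .. 0})"
  have "compactin (product_topology (\<lambda>_. euclidean) UNIV) ?B"
    unfolding compactin_PiE by (simp add: compactin_euclidean_iff)
  then have "compact ?B"
    by (simp add: euclidean_product_topology compactin_euclidean_iff)
  moreover have "?B \<noteq> {}"
    using nonneg by (auto simp: PiE_eq_empty_iff)
  moreover have "continuous_on ?B F"
    unfolding continuous_on_def
  proof
    fix h0
    have "((\<lambda>h. h i) \<longlongrightarrow> h0 i) (at h0 within ?B)" for i
      using continuous_on_product_coordinates[of i]
      by (metis UNIV_I continuous_on_def tendsto_within_subset top_greatest)
    then have "((\<lambda>h. L * (\<Sum>i\<in>I. \<bar>h i - h0 i\<bar>)) \<longlongrightarrow> L * (\<Sum>i\<in>I. \<bar>h0 i - h0 i\<bar>)) (at h0 within ?B)"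
      by (intro tendsto_intros)
    then have "((\<lambda>h. L * (\<Sum>i\<in>I. \<bar>h i - h0 i\<bar>)) \<longlongrightarrow> 0) (at h0 within ?B)"
      by simp
    then have "((\<lambda>h. F h - F h0) \<longlongrightarrow> 0) (at h0 within ?B)"
      by (rule Lim_null_comparison[rotated]) (use lip in simp)
    then show "(F \<longlongrightarrow> F h0) (at h0 within ?B)"
      by (rule LIM_zero_cancel)
  qed
  ultimately obtain h where h: "\<And>h'. h' \<in> ?B \<Longrightarrow> F h' \<le> F h"
    using continuous_attains_sup[of ?B F] by metis
  show ?thesis
    by (intro exI allI impI, rule h) (simp add: PiE_iff)
qed

section \<open>Log-sum-exp and softmax weights\<close>

definition logsumexp :: "'i set \<Rightarrow> ('i \<Rightarrow> real) \<Rightarrow> real"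
  where "logsumexp I u = ln (\<Sum>i\<in>I. exp (u i))"

context
  fixes I :: "'i set"
  assumes fin: "finite I" and ne: "I \<noteq> {}"
begin

lemma sum_exp_pos: "(\<Sum>i\<in>I. exp (u i :: real)) > 0"
  using fin ne by (intro sum_pos) auto

lemma le_logsumexp: "i \<in> I \<Longrightarrow> u i \<le> logsumexp I u"
proof -
  assume "i \<in> I"
  then have "exp (u i) \<le> (\<Sum>i\<in>I. exp (u i))"
    using fin by (intro member_le_sum) auto
  then show ?thesis
    using sum_exp_pos[of u] by (simp add: logsumexp_def ln_ge_iff)
qed

text \<open>Monotonicity and equivariance under constant shifts in one inequality. This is what
  makes \<open>logsumexp\<close> behave like a maximum; several bounds below are instances of
  it.\<close>

lemma logsumexp_le_add:
  assumes "\<And>i. i \<in> I \<Longrightarrow> u i \<le> v i + b"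
  shows "logsumexp I u \<le> logsumexp I v + b"
proof -
  have "(\<Sum>i\<in>I. exp (u i)) \<le> (\<Sum>i\<in>I. exp (v i)) * exp b"
    unfolding sum_distrib_right by (intro sum_mono) (simp add: assms flip: exp_add)
  then have "logsumexp I u \<le> ln ((\<Sum>i\<in>I. exp (v i)) * exp b)"
    unfolding logsumexp_def using sum_exp_pos by (subst ln_le_cancel_iff) auto
  then show ?thesis
    using sum_exp_pos[of v] by (simp add: logsumexp_def ln_mult)
qed

lemma logsumexp_le:
  assumes "\<And>i. i \<in> I \<Longrightarrow> u i \<le> b"
  shows "logsumexp I u \<le> ln (card I) + b"
  using logsumexp_le_add[of u "\<lambda>_. 0" b] assms by (simp add: logsumexp_def)

lemma logsumexp_add: "logsumexp I (\<lambda>i. u i + b) = logsumexp I u + b"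
  using logsumexp_le_add[of "\<lambda>i. u i + b" u b] logsumexp_le_add[of u "\<lambda>i. u i + b" "-b"] by simp

lemma abs_logsumexp_diff:
  "\<bar>logsumexp I u - logsumexp I v\<bar> \<le> (\<Sum>i\<in>I. \<bar>u i - v i\<bar>)"
proof -
  have "\<bar>u i - v i\<bar> \<le> (\<Sum>i\<in>I. \<bar>u i - v i\<bar>)" if "i \<in> I" for i
    using that fin by (intro member_le_sum) auto
  then have "u i \<le> v i + (\<Sum>i\<in>I. \<bar>u i - v i\<bar>)" "v i \<le> u i + (\<Sum>i\<in>I. \<bar>u i - v i\<bar>)" if "i \<in> I" for i
    using that by fastforce+
  then show ?thesis
    using logsumexp_le_add[of u v] logsumexp_le_add[of v u] by (smt (verit, best))
qed

text \<open>From \<open>ln z \<le> z - 1\<close> for the ratio of the two exponential sums. The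
  bound is exact at \<open>s = 0\<close> and its slope there is the softmax weight of
  \<open>i\<close>; integrating it yields the first-order condition at a maximiser without
  differentiating under the integral sign.\<close>

lemma logsumexp_fun_upd_le:
  assumes "i \<in> I"
  shows "logsumexp I (u(i := u i + s)) - logsumexp I u \<le> (exp s - 1) * exp (u i - logsumexp I u)"
proof -
  let ?Z = "\<Sum>j\<in>I. exp (u j)"
  have Z: "exp (logsumexp I u) = ?Z"
    using sum_exp_pos[of u] by (simp add: logsumexp_def)
  have eq: "(\<Sum>j\<in>I. exp ((u(i := u i + s)) j)) = ?Z + (exp s - 1) * exp (u i)"
    using assms fin by (subst (1 2) sum.remove[of _ i]) (auto simp: exp_add algebra_simps)
  have pos: "?Z + (exp s - 1) * exp (u i) > 0"
    unfolding eq[symmetric] by (rule sum_exp_pos)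
  have "logsumexp I (u(i := u i + s)) - logsumexp I u = ln ((?Z + (exp s - 1) * exp (u i)) / ?Z)"
    unfolding logsumexp_def eq using pos sum_exp_pos[of u] by (simp add: ln_div)
  also have "\<dots> \<le> (?Z + (exp s - 1) * exp (u i)) / ?Z - 1"
    using pos sum_exp_pos[of u] by (intro ln_le_minus_one) auto
  also have "\<dots> = (exp s - 1) * exp (u i - logsumexp I u)"
    using sum_exp_pos[of u] by (simp add: exp_diff Z field_simps)
  finally show ?thesis .
qed

lemma sum_softmax: "(\<Sum>i\<in>I. exp (u i - logsumexp I u)) = 1"
  using sum_exp_pos[of u] by (simp add: exp_diff logsumexp_def flip: sum_divide_distrib)

text \<open>The left side is the Shannon entropy of the softmax weights, which is largest for
  uniform weights (Gibbs' inequality).\<close>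

lemma entropy_softmax_le:
  "(\<Sum>i\<in>I. exp (u i - logsumexp I u) * (logsumexp I u - u i)) \<le> ln (card I)"
proof -
  let ?p = "\<lambda>i. exp (u i - logsumexp I u)" and ?n = "real (card I)"
  have n: "?n > 0" using fin ne by (simp add: card_gt_0_iff)
  \<comment> \<open>Termwise Gibbs inequality: \<open>ln z \<le> z - 1\<close> at
    \<open>z = 1 / (?n * ?p i)\<close>. In the sum the terms \<open>1 / ?n - ?p i\<close>
    cancel.\<close>
  have "?p i * (logsumexp I u - u i) \<le> 1 / ?n - ?p i + ?p i * ln ?n" for i
  proof -
    have "ln (1 / (?n * ?p i)) \<le> 1 / (?n * ?p i) - 1"
      using n by (intro ln_le_minus_one) auto
    then have "?p i * ln (1 / (?n * ?p i)) \<le> ?p i * (1 / (?n * ?p i) - 1)"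
      by (intro mult_left_mono) auto
    moreover have "ln (1 / (?n * ?p i)) = logsumexp I u - u i - ln ?n"
      using n by (simp add: ln_div ln_mult)
    moreover have "?p i * (1 / (?n * ?p i) - 1) = 1 / ?n - ?p i"
      using n by (simp add: right_diff_distrib)
    ultimately show ?thesis
      by (simp add: right_diff_distrib)
  qed
  then have "(\<Sum>i\<in>I. ?p i * (logsumexp I u - u i)) \<le> (\<Sum>i\<in>I. 1 / ?n - ?p i + ?p i * ln ?n)"
    by (intro sum_mono) auto
  also have "\<dots> = ln ?n"
    using n by (simp add: sum.distrib sum_subtractf sum_softmax flip: sum_distrib_right)
  finally show ?thesis .
qed

end

text \<open>Regularisation at temperature 1; temperature \<epsilon> is obtained from the rescaled
  costs \<open>d / \<epsilon>\<close>. For fixed \<open>y\<close> the weights \<open>p h i y\<close>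
  form the conditional law of \<open>i\<close> given \<open>y\<close>, and their entropy is the
  source of the error \<open>ln (card I)\<close>.\<close>

lemma (in prob_space) entropic_transport_dual:
  fixes c :: "'i \<Rightarrow> 'a \<Rightarrow> real"
  assumes fin: "finite I" and ne: "I \<noteq> {}"
    and int_c: "\<And>i. i \<in> I \<Longrightarrow> integrable M (c i)" and c_nonneg: "\<And>i y. i \<in> I \<Longrightarrow> 0 \<le> c i y"
  defines "S \<equiv> \<lambda>h y. logsumexp I (\<lambda>j. h j - c j y)"
  defines "p \<equiv> \<lambda>h i y. exp (h i - c i y - S h y)"
  shows "\<exists>h. (\<forall>i\<in>I. expectation (p h i) = 1 / card I) \<and>
    expectation (\<lambda>y. \<Sum>i\<in>I. p h i y * c i y) \<le> (\<Sum>i\<in>I. h i) / card I - expectation (S h) + ln (card I)"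
proof -
  have n: "real (card I) > 0" "real (card I) \<ge> 1"
    using fin ne by (auto simp: card_gt_0_iff Suc_le_eq)
  have [measurable]: "c i \<in> borel_measurable M" if "i \<in> I" for i
    using int_c[OF that] by simp
  have S_measurable [measurable]: "S h \<in> borel_measurable M" for h
    unfolding S_def logsumexp_def by (intro borel_measurable_ln borel_measurable_sum) measurable
  have p_measurable: "p h i \<in> borel_measurable M" if "i \<in> I" for h i
    using that unfolding p_def by measurable
  have int_S: "integrable M (S h)" for h
  proof (rule Bochner_Integration.integrable_bound)
    show "integrable M (\<lambda>y. ln (card I) + (\<Sum>i\<in>I. \<bar>h i - c i y\<bar>))"
      by (intro Bochner_Integration.integrable_add Bochner_Integration.integrable_sum
        integrable_abs Bochner_Integration.integrable_diff) (auto intro: int_c)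
    \<comment> \<open>Comparison with zero exponents, where \<open>logsumexp\<close> equals
      \<open>ln (card I)\<close>.\<close>
    have "\<bar>S h y - ln (card I)\<bar> \<le> (\<Sum>i\<in>I. \<bar>h i - c i y\<bar>)" for y
      using abs_logsumexp_diff[OF fin ne, of "\<lambda>j. h j - c j y" "\<lambda>_. 0"]
      by (simp add: S_def logsumexp_def)
    moreover have "ln (card I) \<ge> 0" using n by simp
    ultimately show "AE y in M. norm (S h y) \<le> norm (ln (card I) + (\<Sum>i\<in>I. \<bar>h i - c i y\<bar>))"
      by (intro AE_I2) (smt (verit, best) real_norm_def)
  qed measurable
  have p_le_1: "p h i y \<le> 1" if "i \<in> I" for h i y
    using le_logsumexp[OF fin ne that, of "\<lambda>j. h j - c j y"] by (simp add: p_def S_def)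
  have p_pos: "p h i y \<ge> 0" for h i y by (simp add: p_def)
  have int_p: "integrable M (p h i)" if "i \<in> I" for h i
    by (intro integrable_const_bound[where B=1] AE_I2 p_measurable[OF that])
      (use that p_le_1 p_pos in simp)
  define \<Phi> where "\<Phi> h = (\<Sum>i\<in>I. h i) / card I - expectation (S h)" for h :: "'i \<Rightarrow> real"
  define D where "D = (\<Sum>i\<in>I. expectation (c i))"
  \<comment> \<open>Chosen so that \<open>- R / card I + D = - ln (card I)\<close>: a function with
    maximum 0 and a coordinate below \<open>- R\<close> then has \<Phi> at most the lower bound for
    \<Phi> at the zero function.\<close>
  define R where "R = card I * (D + ln (card I))"
  have D: "expectation (c k) \<le> D" if "k \<in> I" for k
    unfolding D_def using that fin c_nonneg by (intro member_le_sum integral_nonneg_AE) auto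
  have "D \<ge> 0"
    unfolding D_def using c_nonneg by (intro sum_nonneg integral_nonneg_AE) auto
  then have "R \<ge> 0"
    using n by (simp add: R_def)
  \<comment> \<open>The constant 2 counts one contribution from the average of \<open>h\<close> and
    one from the expectation of \<open>S h\<close>.\<close>
  have \<Phi>_lipschitz: "\<bar>\<Phi> h - \<Phi> h'\<bar> \<le> 2 * (\<Sum>i\<in>I. \<bar>h i - h' i\<bar>)" for h h'
  proof -
    let ?d = "\<Sum>i\<in>I. \<bar>h i - h' i\<bar>"
    have "\<bar>S h y - S h' y\<bar> \<le> ?d" for y
      using abs_logsumexp_diff[OF fin ne, of "\<lambda>j. h j - c j y" "\<lambda>j. h' j - c j y"] by (simp add: S_def)
    then have "\<bar>expectation (\<lambda>y. S h y - S h' y)\<bar> \<le> expectation (\<lambda>_. ?d)"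
      using int_S by (intro order_trans[OF integral_abs_bound] integral_mono) auto
    then have 1: "\<bar>expectation (S h) - expectation (S h')\<bar> \<le> ?d"
      using int_S by (simp add: prob_space)
    have "\<bar>(\<Sum>i\<in>I. h i) / card I - (\<Sum>i\<in>I. h' i) / card I\<bar> = \<bar>\<Sum>i\<in>I. h i - h' i\<bar> / card I"
      using n by (simp add: sum_subtractf flip: diff_divide_distrib)
    also have "\<dots> \<le> ?d / card I"
      using n by (intro divide_right_mono sum_abs) auto
    also have "\<dots> \<le> ?d"
      using n divide_left_mono[of 1 "card I" ?d] by (simp add: sum_nonneg)
    finally show ?thesis
      using 1 unfolding \<Phi>_def by linarith
  qed
  \<comment> \<open>Of the soft maximum \<open>S h\<close> only the single term
    \<open>h k - c k\<close> is kept.\<close>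
  have \<Phi>_le: "\<Phi> h \<le> (\<Sum>i\<in>I. h i) / card I - h k + D" if "k \<in> I" for h k
  proof -
    have "expectation (\<lambda>y. h k - c k y) \<le> expectation (S h)"
      using int_S int_c[OF that] le_logsumexp[OF fin ne that, of "\<lambda>j. h j - c j _"]
      by (intro integral_mono) (auto simp: S_def)
    then show ?thesis
      using D[OF that] int_c[OF that] by (simp add: \<Phi>_def prob_space)
  qed
  have \<Phi>_0: "\<Phi> (\<lambda>_. 0) \<ge> - ln (card I)"
  proof -
    have "S (\<lambda>_. 0) y \<le> ln (card I)" for y
      using logsumexp_le[OF fin ne, of "\<lambda>j. - c j y" 0] c_nonneg by (simp add: S_def)
    then have "expectation (S (\<lambda>_. 0)) \<le> expectation (\<lambda>_. ln (card I))"
      using int_S by (intro integral_mono) auto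
    then show ?thesis
      by (simp add: \<Phi>_def prob_space)
  qed
  \<comment> \<open>Coordinates outside \<open>I\<close> are pinned to 0, so that the box is a
    product over the whole index type.\<close>
  have "\<exists>h. \<forall>h'. (\<forall>i. - (if i \<in> I then R else 0) \<le> h' i \<and> h' i \<le> 0) \<longrightarrow> \<Phi> h' \<le> \<Phi> h"
    by (rule continuous_attains_sup_box[OF fin _ \<Phi>_lipschitz]) (use \<open>R \<ge> 0\<close> in simp)
  then obtain h where h: "(\<forall>i. - (if i \<in> I then R else 0) \<le> h' i \<and> h' i \<le> 0) \<Longrightarrow> \<Phi> h' \<le> \<Phi> h" for h'
    by meson
  \<comment> \<open>The maximum over the box is global: \<^term>\<open>\<Phi>\<close> is invariant under constant shifts, and outside
    the box a function with maximum \<open>0\<close> does worse than the zero function.\<close>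
  have h_max: "\<Phi> h0 \<le> \<Phi> h" for h0
  proof -
    define m where "m = Max (h0 ` I)"
    define h' where "h' i = (if i \<in> I then h0 i - m else 0)" for i
    have "m \<in> h0 ` I"
      unfolding m_def using fin ne by (intro Max_in) auto
    then obtain k where k: "k \<in> I" "h' k = 0"
      by (auto simp: h'_def)
    have nonpos: "h' i \<le> 0" for i
      using fin ne by (simp add: h'_def m_def)
    have "S h' = (\<lambda>y. S h0 y - m)"
    proof
      fix y
      have "S h' y = logsumexp I (\<lambda>j. (h0 j - c j y) + - m)"
        unfolding S_def logsumexp_def h'_def
        by (intro arg_cong[where f=ln] sum.cong) (auto simp: algebra_simps)
      then show "S h' y = S h0 y - m"
        unfolding logsumexp_add[OF fin ne] by (simp add: S_def)
    qed
    then have "expectation (S h') = expectation (S h0) - m"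
      using int_S by (simp add: prob_space)
    moreover have "(\<Sum>i\<in>I. h' i) / card I = (\<Sum>i\<in>I. h0 i) / card I - m"
      using n by (simp add: h'_def sum_subtractf field_simps)
    ultimately have eq: "\<Phi> h' = \<Phi> h0"
      by (simp add: \<Phi>_def)
    show ?thesis
    proof (cases "\<forall>i\<in>I. - R \<le> h' i")
      case True
      then have "\<Phi> h' \<le> \<Phi> h"
        using nonpos by (intro h) (auto simp: h'_def)
      then show ?thesis using eq by simp
    next
      case False
      then obtain j where j: "j \<in> I" "h' j < - R" by force
      have "(\<Sum>i\<in>I. h' i) \<le> h' j"
        using j fin nonpos by (subst sum.remove[OF fin j(1)]) (auto intro: sum_nonpos)
      then have "(\<Sum>i\<in>I. h' i) / card I \<le> - R / card I"
        using j n by (intro divide_right_mono) auto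
      also have "\<dots> = - D - ln (card I)"
        using n by (simp add: R_def)
      finally have "\<Phi> h' \<le> - ln (card I)"
        using \<Phi>_le[OF k(1), of h'] k(2) by simp
      also have "\<dots> \<le> \<Phi> (\<lambda>_. 0)"
        by (rule \<Phi>_0)
      also have "\<dots> \<le> \<Phi> h"
        by (rule h) (use \<open>R \<ge> 0\<close> in simp)
      finally show ?thesis using eq by simp
    qed
  qed
  have p_int: "expectation (p h i) = 1 / card I" if i: "i \<in> I" for i
  proof -
    define P where "P = expectation (p h i)"
    \<comment> \<open>Maximality of \<open>h\<close> against a shift of coordinate \<open>i\<close>
      by \<open>s\<close>. Both sides vanish at \<open>s = 0\<close>, so their difference is minimal
      there; its derivative \<open>P - 1 / card I\<close> must be 0.\<close>
    have *: "s / card I \<le> (exp s - 1) * P" for s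
    proof -
      let ?h = "h(i := h i + s)"
      have "S ?h y - S h y \<le> (exp s - 1) * p h i y" for y
      proof -
        have "(\<lambda>j. h j - c j y)(i := h i - c i y + s) = (\<lambda>j. ?h j - c j y)"
          by auto
        then show ?thesis
          using logsumexp_fun_upd_le[OF fin ne i, of "\<lambda>j. h j - c j y" s] by (simp add: S_def p_def)
      qed
      then have "expectation (\<lambda>y. S ?h y - S h y) \<le> expectation (\<lambda>y. (exp s - 1) * p h i y)"
        using int_S int_p[OF i] by (intro integral_mono) auto
      then have "expectation (S ?h) - expectation (S h) \<le> (exp s - 1) * P"
        using int_S by (simp add: P_def)
      moreover have "(\<Sum>j\<in>I. ?h j) = (\<Sum>j\<in>I. h j) + s"
        using i fin by (simp add: sum.remove[of _ i])
      ultimately show ?thesis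
        using h_max[of ?h] by (simp add: \<Phi>_def add_divide_distrib)
    qed
    have "((\<lambda>s. (exp s - 1) * P - s / card I) has_real_derivative exp 0 * P - 1 / card I) (at 0)"
      using n by (auto intro!: derivative_eq_intros)
    then have "exp 0 * P - 1 / card I = 0"
      by (rule DERIV_local_min[where d=1]) (use * in auto)
    then show ?thesis by (simp add: P_def)
  qed
  have int_pc: "integrable M (\<lambda>y. p h i y * c i y)" if "i \<in> I" for i
  proof (rule Bochner_Integration.integrable_bound[OF int_c[OF that]])
    show "AE y in M. norm (p h i y * c i y) \<le> norm (c i y)"
      using p_le_1[OF that] p_pos c_nonneg[OF that] by (auto simp: abs_mult intro!: mult_left_le_one_le)
    show "(\<lambda>y. p h i y * c i y) \<in> borel_measurable M"
      using that p_measurable[OF that] by measurable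
  qed
  have "expectation (\<lambda>y. \<Sum>i\<in>I. p h i y * c i y) \<le>
      expectation (\<lambda>y. (\<Sum>i\<in>I. p h i y * h i) - S h y + ln (card I))"
  proof (rule integral_mono)
    fix y
    let ?q = "\<lambda>i. p h i y"
    \<comment> \<open>\<open>S h y - (h i - c i y)\<close> is \<open>- ln (?q i)\<close>, so the
      middle terms add up to the entropy of the softmax weights.\<close>
    have "(\<Sum>i\<in>I. ?q i * c i y) = (\<Sum>i\<in>I. ?q i * h i + ?q i * (S h y - (h i - c i y)) - ?q i * S h y)"
      by (intro sum.cong) (auto simp: algebra_simps)
    also have "\<dots> = (\<Sum>i\<in>I. ?q i * h i) + (\<Sum>i\<in>I. ?q i * (S h y - (h i - c i y))) - S h y"
      using sum_softmax[OF fin ne, of "\<lambda>j. h j - c j y"]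
      by (simp add: sum.distrib sum_subtractf p_def S_def flip: sum_distrib_right)
    also have "\<dots> \<le> (\<Sum>i\<in>I. ?q i * h i) - S h y + ln (card I)"
      using entropy_softmax_le[OF fin ne, of "\<lambda>j. h j - c j y"] by (simp add: p_def S_def)
    finally show "(\<Sum>i\<in>I. ?q i * c i y) \<le> (\<Sum>i\<in>I. ?q i * h i) - S h y + ln (card I)" .
  qed (use int_S int_p int_pc in \<open>auto intro!: Bochner_Integration.integrable_sum Bochner_Integration.integrable_diff\<close>)
  also have "\<dots> = (\<Sum>i\<in>I. expectation (p h i) * h i) - expectation (S h) + ln (card I)"
    using int_S int_p by (simp add: prob_space Bochner_Integration.integral_sum)
  also have "\<dots> = (\<Sum>i\<in>I. h i) / card I - expectation (S h) + ln (card I)"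
    by (simp add: p_int sum_divide_distrib)
  finally show ?thesis
    using p_int by blast
qed

subsection \<open>Kantorovich duality for empirical measures\<close>

lemma prob_measuresD:
  assumes "\<mu> \<in> prob_measures"
  shows "prob_space \<mu>" "sets \<mu> = sets borel"
  using assms by (auto simp: prob_measures_def)

text \<open>The coupling draws \<open>y\<close> from \<mu> and then an index \<open>i\<close> with
  probability \<open>p i y\<close>, and pairs \<open>x i\<close> with \<open>y\<close>. It is built
  on indices rather than points because the \<open>x i\<close> may coincide. \<open>p_int\<close>
  yields the first marginal, \<open>p_sum\<close> the second.\<close>

lemma W1_empirical_le:
  fixes \<mu> :: "'a::polish_space measure"
  assumes \<mu>: "\<mu> \<in> prob_measures" and "n \<ge> 1"
    and p_meas: "\<And>i. i \<in> {1..n} \<Longrightarrow> p i \<in> borel_measurable \<mu>"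
    and p_nonneg: "\<And>i y. p i y \<ge> (0::real)"
    and p_sum: "\<And>y. (\<Sum>i=1..n. p i y) = 1"
    and p_int: "\<And>i. i \<in> {1..n} \<Longrightarrow> (\<integral>\<^sup>+ y. p i y \<partial>\<mu>) = ennreal (1 / n)"
  shows "W1 (empirical_measure n x) \<mu> \<le> (\<integral>\<^sup>+ y. (\<Sum>i=1..n. p i y * dist (x i) y) \<partial>\<mu>)"
proof -
  note sets_\<mu> [measurable_cong, simp] = prob_measuresD(2)[OF \<mu>]
  interpret prob_space \<mu> by (rule prob_measuresD[OF \<mu>])
  let ?C = "count_space {1..n}"
  define \<pi> where "\<pi> = distr (density (?C \<Otimes>\<^sub>M \<mu>) (\<lambda>(i, y). ennreal (p i y))) borel (\<lambda>(i, y). (x i, y))"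
  have [measurable]: "(\<lambda>(i, y). ennreal (p i y)) \<in> borel_measurable (?C \<Otimes>\<^sub>M \<mu>)"
    using p_meas by (intro measurable_pair_measure_countable1) auto
  have [measurable]: "(\<lambda>(i, y). (x i, y)) \<in> ?C \<Otimes>\<^sub>M \<mu> \<rightarrow>\<^sub>M borel"
    by (intro measurable_pair_measure_countable1) (auto simp flip: borel_prod)
  \<comment> \<open>Integrals against \<pi> become finite sums of integrals against \<mu>; the
    marginals, the total mass and the cost are all read off from this formula.\<close>
  have nn_\<pi>: "(\<integral>\<^sup>+ z. F z \<partial>\<pi>) = (\<Sum>i=1..n. \<integral>\<^sup>+ y. ennreal (p i y) * F (x i, y) \<partial>\<mu>)"
    if [measurable]: "F \<in> borel_measurable borel" for F
  proof -
    have "(\<integral>\<^sup>+ z. F z \<partial>\<pi>) = (\<integral>\<^sup>+ z. (case z of (i, y) \<Rightarrow> ennreal (p i y)) * F (case z of (i, y) \<Rightarrow> (x i, y)) \<partial>(?C \<Otimes>\<^sub>M \<mu>))"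
      unfolding \<pi>_def by (subst nn_integral_distr; (subst nn_integral_density)?) (auto simp del: One_nat_def)
    also have "\<dots> = (\<integral>\<^sup>+ i. \<integral>\<^sup>+ y. ennreal (p i y) * F (x i, y) \<partial>\<mu> \<partial>?C)"
      by (subst nn_integral_fst[symmetric]) (auto simp del: One_nat_def)
    finally show ?thesis
      by (simp add: nn_integral_count_space_finite)
  qed
  have em_\<pi>: "emeasure \<pi> A = (\<Sum>i=1..n. \<integral>\<^sup>+ y. ennreal (p i y) * indicator A (x i, y) \<partial>\<mu>)"
    if "A \<in> sets borel" for A
    using nn_\<pi>[of "indicator A"] that by (simp add: \<pi>_def)
  have [measurable_cong, simp]: "sets \<pi> = sets borel" "space \<pi> = UNIV"
    by (simp_all add: \<pi>_def)
  have [measurable]: "fst \<in> borel_measurable (borel :: ('a \<times> 'a) measure)"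
      "snd \<in> borel_measurable (borel :: ('a \<times> 'a) measure)"
    by (simp_all flip: borel_prod)
  have "distr \<pi> borel fst = empirical_measure n x"
  proof (rule measure_eqI)
    fix A :: "'a set" assume "A \<in> sets (distr \<pi> borel fst)"
    then have A [measurable]: "A \<in> sets borel" by simp
    have "emeasure (distr \<pi> borel fst) A = emeasure \<pi> (A \<times> UNIV)"
      by (subst emeasure_distr) (auto intro!: arg_cong[where f="emeasure \<pi>"])
    also have "\<dots> = (\<Sum>i=1..n. \<integral>\<^sup>+ y. ennreal (p i y) * indicator A (x i) \<partial>\<mu>)"
      by (subst em_\<pi>) (auto simp: indicator_def borel_prod[symmetric])
    also have "\<dots> = (\<Sum>i=1..n. ennreal (1 / n) * indicator A (x i))"
      using p_meas by (intro sum.cong) (simp_all add: nn_integral_multc p_int)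
    also have "\<dots> = emeasure (empirical_measure n x) A"
      by (simp add: emeasure_empirical_measure sum_distrib_left)
    finally show "emeasure (distr \<pi> borel fst) A = emeasure (empirical_measure n x) A" .
  qed simp
  moreover have "distr \<pi> borel snd = \<mu>"
  proof (rule measure_eqI)
    fix A :: "'a set" assume "A \<in> sets (distr \<pi> borel snd)"
    then have A [measurable]: "A \<in> sets borel" by simp
    have "emeasure (distr \<pi> borel snd) A = emeasure \<pi> (UNIV \<times> A)"
      by (subst emeasure_distr) (auto intro!: arg_cong[where f="emeasure \<pi>"])
    also have "\<dots> = (\<Sum>i=1..n. \<integral>\<^sup>+ y. ennreal (p i y) * indicator A y \<partial>\<mu>)"
      by (subst em_\<pi>) (auto simp: indicator_def borel_prod[symmetric])
    also have "\<dots> = (\<integral>\<^sup>+ y. ennreal (\<Sum>i=1..n. p i y) * indicator A y \<partial>\<mu>)"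
      using p_meas p_nonneg
      by (subst nn_integral_sum[symmetric]) (auto simp: sum_ennreal simp flip: sum_distrib_right)
    also have "\<dots> = emeasure \<mu> A"
      unfolding p_sum by simp
    finally show "emeasure (distr \<pi> borel snd) A = emeasure \<mu> A" .
  qed simp
  moreover have "prob_space \<pi>"
  proof
    have "emeasure \<pi> (space \<pi>) = (\<Sum>i=1..n. ennreal (1 / n))"
      by (subst em_\<pi>) (auto simp: p_int)
    also have "\<dots> = ennreal (\<Sum>i=1..n. 1 / n)"
      by (rule sum_ennreal) simp
    also have "\<dots> = 1"
      using \<open>n \<ge> 1\<close> by simp
    finally show "emeasure \<pi> (space \<pi>) = 1" .
  qed
  ultimately have "\<pi> \<in> couplings (empirical_measure n x) \<mu>"
    by (simp add: couplings_def prob_measures_def)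
  then have "W1 (empirical_measure n x) \<mu> \<le> (\<integral>\<^sup>+ z. (case z of (x, y) \<Rightarrow> ennreal (dist x y)) \<partial>\<pi>)"
    unfolding W1_def by (rule INF_lower)
  also have "\<dots> = (\<Sum>i=1..n. \<integral>\<^sup>+ y. ennreal (p i y) * ennreal (dist (x i) y) \<partial>\<mu>)"
    by (subst nn_\<pi>) (auto simp flip: borel_prod)
  also have "\<dots> = (\<integral>\<^sup>+ y. (\<Sum>i=1..n. p i y * dist (x i) y) \<partial>\<mu>)"
    using p_meas p_nonneg
    by (subst nn_integral_sum[symmetric]) (auto simp: sum_ennreal simp flip: ennreal_mult intro!: nn_integral_cong)
  finally show ?thesis .
qed

lemma prob_measures_1_integrable_dist:
  assumes "\<mu> \<in> prob_measures_1"
  shows "integrable \<mu> (dist x)"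
proof -
  from assms have \<mu>: "\<mu> \<in> prob_measures" by (simp add: prob_measures_1_def)
  note [measurable_cong] = prob_measuresD(2)[OF \<mu>]
  interpret prob_space \<mu> by (rule prob_measuresD[OF \<mu>])
  have [measurable]: "dist x \<in> borel_measurable borel"
    by (intro borel_measurable_continuous_onI continuous_intros)
  obtain x0 where x0: "integrable \<mu> (dist x0)"
    using assms by (auto simp: prob_measures_1_def)
  show ?thesis
  proof (rule Bochner_Integration.integrable_bound)
    show "integrable \<mu> (\<lambda>y. dist x x0 + dist x0 y)" using x0 by simp
  qed (auto intro: dist_triangle)
qed

lemma lipschitz_measurable:
  fixes f :: "'a::metric_space \<Rightarrow> real"
  assumes "L-lipschitz_on UNIV f"
  shows "f \<in> borel_measurable borel"
  using lipschitz_on_continuous_on[OF assms] by (rule borel_measurable_continuous_onI)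

lemma lipschitz_1D:
  fixes f :: "'a::metric_space \<Rightarrow> real"
  assumes "1-lipschitz_on U f" "x \<in> U" "y \<in> U"
  shows "f x \<le> f y + dist x y"
  using lipschitz_onD[OF assms] by (simp add: dist_real_def)

lemma lipschitz_1I:
  fixes f :: "'a::metric_space \<Rightarrow> real"
  assumes "\<And>x y. x \<in> U \<Longrightarrow> y \<in> U \<Longrightarrow> f x \<le> f y + dist x y"
  shows "1-lipschitz_on U f"
proof (rule lipschitz_onI)
  fix x y assume "x \<in> U" "y \<in> U"
  then show "dist (f x) (f y) \<le> 1 * dist x y"
    using assms[of x y] assms[of y x] by (auto simp: dist_real_def dist_commute)
qed simp

lemma lipschitz_integrable:
  fixes f :: "'a::metric_space \<Rightarrow> real"
  assumes \<mu>: "\<mu> \<in> prob_measures_1" and f: "1-lipschitz_on UNIV f"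
  shows "integrable \<mu> f"
proof -
  from \<mu> have \<mu>': "\<mu> \<in> prob_measures" by (simp add: prob_measures_1_def)
  note [measurable_cong] = prob_measuresD(2)[OF \<mu>']
  interpret prob_space \<mu> by (rule prob_measuresD[OF \<mu>'])
  define x where "x = (undefined :: 'a)"
  have [measurable]: "f \<in> borel_measurable borel" by (rule lipschitz_measurable[OF f])
  show ?thesis
  proof (rule Bochner_Integration.integrable_bound)
    show "integrable \<mu> (\<lambda>y. \<bar>f x\<bar> + dist x y)"
      using prob_measures_1_integrable_dist[OF \<mu>, of x] by simp
    have "\<bar>f y\<bar> \<le> \<bar>f x\<bar> + dist x y" for y
      using lipschitz_1D[OF f, of x y] lipschitz_1D[OF f, of y x] by (simp add: dist_commute)
    then show "AE y in \<mu>. norm (f y) \<le> norm (\<bar>f x\<bar> + dist x y)" by simp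
  qed measurable
qed

text \<open>The hard half of Kantorovich duality up to an error \<eta>: the entropic dual is applied
  to the costs \<open>d / \<epsilon>\<close>, with \<epsilon> small enough to absorb the entropy
  term.\<close>

lemma W1_empirical_approx_dual:
  fixes \<mu> :: "'a::polish_space measure"
  assumes \<mu>: "\<mu> \<in> prob_measures_1" and "n \<ge> 1" and "\<eta> > 0"
  shows "\<exists>g. 1-lipschitz_on UNIV g \<and>
    W1 (empirical_measure n x) \<mu> \<le> ennreal (integral\<^sup>L \<mu> g - (\<Sum>i=1..n. g (x i)) / n + \<eta>)"
proof -
  from \<mu> have \<mu>': "\<mu> \<in> prob_measures" by (simp add: prob_measures_1_def)
  note [measurable_cong] = prob_measuresD(2)[OF \<mu>']
  interpret prob_space \<mu> by (rule prob_measuresD[OF \<mu>'])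
  \<comment> \<open>This makes \<open>\<epsilon> * ln n \<le> \<eta>\<close>; the summand 1 keeps
    the denominator positive when \<open>n = 1\<close>.\<close>
  define \<epsilon> where "\<epsilon> = \<eta> / (ln n + 1)"
  have "ln (real n) \<ge> 0" using \<open>n \<ge> 1\<close> by simp
  then have \<epsilon>: "\<epsilon> > 0" "\<epsilon> * ln n \<le> \<eta>"
    using \<open>\<eta> > 0\<close> by (auto simp: \<epsilon>_def field_simps intro!: mult_nonneg_nonneg)
  let ?I = "{1..n}"
  define c where "c i y = dist (x i) y / \<epsilon>" for i y
  define S where "S = (\<lambda>h y. logsumexp ?I (\<lambda>j. h j - c j y))"
  define p where "p = (\<lambda>h i y. exp (h i - c i y - S h y))"
  have ne: "?I \<noteq> {}" using \<open>n \<ge> 1\<close> by simp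
  have int_c: "integrable \<mu> (c i)" for i
    unfolding c_def using prob_measures_1_integrable_dist[OF \<mu>, of "x i"] by simp
  have c_nonneg: "c i y \<ge> 0" for i y using \<epsilon> by (simp add: c_def)
  have card: "card ?I = n" by simp
  have "\<exists>h. (\<forall>i\<in>?I. expectation (p h i) = 1 / card ?I) \<and>
    expectation (\<lambda>y. \<Sum>i\<in>?I. p h i y * c i y) \<le> (\<Sum>i\<in>?I. h i) / card ?I - expectation (S h) + ln (card ?I)"
    unfolding p_def S_def by (rule entropic_transport_dual) (use ne int_c c_nonneg in auto)
  then obtain h where p_int: "\<And>i. i \<in> ?I \<Longrightarrow> expectation (p h i) = 1 / n"
    and cost: "expectation (\<lambda>y. \<Sum>i\<in>?I. p h i y * c i y) \<le>
      (\<Sum>i\<in>?I. h i) / n - expectation (S h) + ln n"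
    unfolding card by blast
  have [measurable]: "S h \<in> borel_measurable \<mu>"
    unfolding S_def logsumexp_def c_def by measurable
  have p_meas [measurable]: "p h i \<in> borel_measurable \<mu>" for i
    unfolding p_def c_def by measurable
  have p_nonneg: "p h i y \<ge> 0" for i y by (simp add: p_def)
  have p_sum: "(\<Sum>i\<in>?I. p h i y) = 1" for y
    using sum_softmax[OF _ ne] by (simp add: p_def S_def)
  have p_le_1: "p h i y \<le> 1" if "i \<in> ?I" for i y
    unfolding p_sum[symmetric, of y] using that p_nonneg by (intro member_le_sum) auto
  have int_pc: "integrable \<mu> (\<lambda>y. p h i y * dist (x i) y)" if "i \<in> ?I" for i
  proof (rule Bochner_Integration.integrable_bound)
    show "integrable \<mu> (dist (x i))" by (rule prob_measures_1_integrable_dist[OF \<mu>])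
    show "AE y in \<mu>. norm (p h i y * dist (x i) y) \<le> norm (dist (x i) y)"
      using p_le_1[OF that] p_nonneg by (auto simp: abs_mult intro!: mult_left_le_one_le)
  qed measurable
  \<comment> \<open>The soft minimum over \<open>j\<close> of
    \<open>dist (x j) y - \<epsilon> * h j\<close>. It inherits the Lipschitz constant 1 from the
    distance functions.\<close>
  define g where "g y = - \<epsilon> * S h y" for y
  have g_lip: "1-lipschitz_on UNIV g"
  proof (rule lipschitz_1I)
    fix y z
    have "S h z \<le> S h y + dist y z / \<epsilon>"
      unfolding S_def
    proof (rule logsumexp_le_add[OF _ ne])
      fix i
      have "dist (x i) y / \<epsilon> \<le> (dist (x i) z + dist y z) / \<epsilon>"
        using \<epsilon> by (intro divide_right_mono) (auto intro: dist_triangle2)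
      then show "h i - c i z \<le> h i - c i y + dist y z / \<epsilon>"
        by (simp add: c_def add_divide_distrib)
    qed simp
    then have "\<epsilon> * S h z \<le> \<epsilon> * (S h y + dist y z / \<epsilon>)"
      using \<epsilon> by (intro mult_left_mono) auto
    then show "g y \<le> g z + dist y z"
      using \<epsilon> by (simp add: g_def distrib_left)
  qed
  \<comment> \<open>Only the term \<open>i\<close> of the soft maximum is kept, and its cost
    vanishes at \<open>x i\<close>.\<close>
  have "g (x i) \<le> - \<epsilon> * h i" if "i \<in> ?I" for i
    using le_logsumexp[OF _ ne that, of "\<lambda>j. h j - c j (x i)"] \<epsilon> by (simp add: g_def S_def c_def)
  then have "(\<Sum>i\<in>?I. g (x i)) / n \<le> (\<Sum>i\<in>?I. - \<epsilon> * h i) / n"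
    by (intro divide_right_mono sum_mono) auto
  then have g_avg: "\<epsilon> * ((\<Sum>i\<in>?I. h i) / n) \<le> - (\<Sum>i\<in>?I. g (x i)) / n"
    by (simp add: sum_negf flip: sum_distrib_left)
  have "W1 (empirical_measure n x) \<mu> \<le> (\<integral>\<^sup>+ y. (\<Sum>i\<in>?I. p h i y * dist (x i) y) \<partial>\<mu>)"
  proof (rule W1_empirical_le[OF \<mu>' \<open>n \<ge> 1\<close>])
    fix i assume i: "i \<in> ?I"
    have "integrable \<mu> (p h i)"
      using p_le_1[OF i] p_nonneg by (intro integrable_const_bound[where B=1]) auto
    then show "(\<integral>\<^sup>+ y. p h i y \<partial>\<mu>) = ennreal (1 / n)"
      using p_nonneg p_int[OF i] by (simp add: nn_integral_eq_integral)
  qed (use p_nonneg p_sum in auto)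
  also have "\<dots> = ennreal (expectation (\<lambda>y. \<Sum>i\<in>?I. p h i y * dist (x i) y))"
    using int_pc p_nonneg by (intro nn_integral_eq_integral) (auto intro!: sum_nonneg)
  also have "(\<lambda>y. \<Sum>i\<in>?I. p h i y * dist (x i) y) = (\<lambda>y. \<epsilon> * (\<Sum>i\<in>?I. p h i y * c i y))"
    using \<epsilon> by (simp add: c_def sum_distrib_left)
  also have "expectation \<dots> \<le> \<epsilon> * ((\<Sum>i\<in>?I. h i) / n - expectation (S h) + ln n)"
    using cost \<epsilon> by simp
  also have "\<dots> \<le> integral\<^sup>L \<mu> g - (\<Sum>i\<in>?I. g (x i)) / n + \<eta>"
  proof -
    have "integral\<^sup>L \<mu> g = - \<epsilon> * expectation (S h)"
      by (simp add: g_def[abs_def])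
    then show ?thesis
      using g_avg \<epsilon> by (simp add: algebra_simps)
  qed
  finally show ?thesis
    using g_lip by (blast intro: ennreal_leI)
qed

subsection \<open>Concentration from the transport inequality\<close>

lemma ennreal_integral_le_nn_integral:
  fixes f :: "'a \<Rightarrow> real"
  assumes "integrable M f"
  shows "ennreal (integral\<^sup>L M f) \<le> (\<integral>\<^sup>+ x. ennreal (f x) \<partial>M)"
proof -
  have int: "integrable M (\<lambda>x. max 0 (f x))" using assms by simp
  have "integral\<^sup>L M f \<le> integral\<^sup>L M (\<lambda>x. max 0 (f x))"
    using assms int by (intro integral_mono) auto
  then have "ennreal (integral\<^sup>L M f) \<le> ennreal (integral\<^sup>L M (\<lambda>x. max 0 (f x)))"
    by (rule ennreal_leI)
  also have "\<dots> = (\<integral>\<^sup>+ x. ennreal (max 0 (f x)) \<partial>M)"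
    using int by (intro nn_integral_eq_integral[symmetric]) auto
  also have "\<dots> = (\<integral>\<^sup>+ x. ennreal (f x) \<partial>M)"
    by (intro nn_integral_cong) (simp add: ennreal_neg max_def)
  finally show ?thesis .
qed

text \<open>The easy half of duality: \<open>f y - f x \<le> dist x y\<close> is integrated against
  an arbitrary coupling. Boundedness secures integrability under each coupling.\<close>

lemma W1_ge_bounded_lipschitz:
  fixes f :: "'a::polish_space \<Rightarrow> real"
  assumes f: "1-lipschitz_on UNIV f" and bounded: "\<And>x. \<bar>f x\<bar> \<le> B"
  shows "ennreal (integral\<^sup>L \<nu> f - integral\<^sup>L \<mu> f) \<le> W1 \<mu> \<nu>"
  unfolding W1_def
proof (rule INF_greatest)
  fix \<pi> assume "\<pi> \<in> couplings \<mu> \<nu>"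
  then have \<pi>: "\<pi> \<in> prob_measures" "distr \<pi> borel fst = \<mu>" "distr \<pi> borel snd = \<nu>"
    by (auto simp: couplings_def)
  note [measurable_cong] = prob_measuresD(2)[OF \<pi>(1)]
  interpret prob_space \<pi> by (rule prob_measuresD[OF \<pi>(1)])
  have [measurable]: "f \<in> borel_measurable borel" by (rule lipschitz_measurable[OF f])
  have [measurable]: "fst \<in> borel_measurable (borel :: ('a \<times> 'a) measure)"
      "snd \<in> borel_measurable (borel :: ('a \<times> 'a) measure)"
    by (simp_all flip: borel_prod)
  have int: "integrable \<pi> (\<lambda>z. f (fst z))" "integrable \<pi> (\<lambda>z. f (snd z))"
    using bounded by (auto intro!: integrable_const_bound[where B=B])
  have "integral\<^sup>L \<nu> f - integral\<^sup>L \<mu> f = expectation (\<lambda>z. f (snd z) - f (fst z))"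
    using int unfolding \<pi>(2,3)[symmetric] by (simp add: integral_distr)
  also have "ennreal \<dots> \<le> (\<integral>\<^sup>+ z. ennreal (f (snd z) - f (fst z)) \<partial>\<pi>)"
    using int by (intro ennreal_integral_le_nn_integral) auto
  also have "\<dots> \<le> (\<integral>\<^sup>+ (x, y). ennreal (dist x y) \<partial>\<pi>)"
  proof (rule nn_integral_mono)
    fix z
    show "ennreal (f (snd z) - f (fst z)) \<le> (case z of (x, y) \<Rightarrow> ennreal (dist x y))"
      using lipschitz_1D[OF f, of "snd z" "fst z"] by (auto simp: dist_commute split_beta intro!: ennreal_leI)
  qed
  finally show "ennreal (integral\<^sup>L \<nu> f - integral\<^sup>L \<mu> f) \<le> (\<integral>\<^sup>+ (x, y). ennreal (dist x y) \<partial>\<pi>)" .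
qed

text \<open>\<open>L\<close> normalises the Gibbs density, whose logarithm is
  \<open>\<phi> - L\<close>; averaging this under \<nu> gives the entropy. The last claim is
  nonnegativity of the relative entropy.\<close>

lemma (in prob_space) relative_entropy_exp_tilt:
  fixes \<phi> :: "'a \<Rightarrow> real"
  assumes [measurable]: "\<phi> \<in> borel_measurable M" and bounded: "\<And>x. \<bar>\<phi> x\<bar> \<le> B"
  defines "L \<equiv> ln (expectation (\<lambda>x. exp (\<phi> x)))"
  defines "\<nu> \<equiv> density M (\<lambda>x. ennreal (exp (\<phi> x - L)))"
  shows "prob_space \<nu>" "relative_entropy \<nu> M = ereal (integral\<^sup>L \<nu> \<phi> - L)" "L \<le> integral\<^sup>L \<nu> \<phi>"
proof -
  have bnds: "exp (- B) \<le> exp (\<phi> x)" "exp (\<phi> x) \<le> exp B" for x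
    using bounded[of x] by auto
  have int_exp: "integrable M (\<lambda>x. exp (\<phi> x))"
    using bnds by (intro integrable_const_bound[where B="exp B"]) auto
  \<comment> \<open>A positive lower bound for the expectation, so that \<open>exp\<close> really
    inverts the \<open>ln\<close> in \<open>L\<close>.\<close>
  have "expectation (\<lambda>x. exp (- B)) \<le> expectation (\<lambda>x. exp (\<phi> x))"
    using int_exp bnds by (intro integral_mono) auto
  then have Z: "exp L = expectation (\<lambda>x. exp (\<phi> x))"
    unfolding L_def using less_le_trans[OF exp_gt_zero[of "- B"]] by (intro exp_ln) (simp add: prob_space)
  have "emeasure \<nu> (space \<nu>) = (\<integral>\<^sup>+ x. ennreal (exp (\<phi> x - L)) \<partial>M)"
    unfolding \<nu>_def by (subst emeasure_density) (auto intro!: nn_integral_cong)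
  also have "\<dots> = ennreal (expectation (\<lambda>x. exp (\<phi> x) / exp L))"
    using int_exp by (simp add: exp_diff nn_integral_eq_integral)
  also have "\<dots> = 1"
    using int_exp by (simp flip: Z)
  finally show prob_\<nu>: "prob_space \<nu>" by (rule prob_spaceI)
  interpret \<nu>: prob_space \<nu> by (rule prob_\<nu>)
  have [measurable_cong]: "sets \<nu> = sets M" by (simp add: \<nu>_def)
  have "density M (RN_deriv M \<nu>) = \<nu>"
    unfolding \<nu>_def by (intro density_RN_deriv_density) auto
  then have "AE x in M. RN_deriv M \<nu> x = ennreal (exp (\<phi> x - L))"
    unfolding \<nu>_def by (intro density_unique) auto
  then have "AE x in M. entropy_density (exp 1) M \<nu> x = \<phi> x - L"
    by (auto simp: entropy_density_def log_def)
  then have ed: "AE x in \<nu>. entropy_density (exp 1) M \<nu> x = \<phi> x - L"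
    unfolding \<nu>_def by (subst AE_density) auto
  have int_\<phi>: "integrable \<nu> \<phi>"
    using bounded by (intro \<nu>.integrable_const_bound[where B=B]) auto
  have int: "integrable \<nu> (entropy_density (exp 1) M \<nu>)"
    using int_\<phi> by (subst integrable_cong_AE[OF _ _ ed]) auto
  have ac: "absolutely_continuous M \<nu>"
    unfolding \<nu>_def by (intro absolutely_continuousI_density) auto
  have KL: "KL_divergence (exp 1) M \<nu> = integral\<^sup>L \<nu> \<phi> - L"
    unfolding KL_divergence_def using int_\<phi>
    by (subst integral_cong_AE[OF _ _ ed]) (auto simp: \<nu>.prob_space)
  show "relative_entropy \<nu> M = ereal (integral\<^sup>L \<nu> \<phi> - L)"
    using ac int by (simp add: relative_entropy_def KL)
  interpret information_space M "exp 1"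
    by unfold_locales simp
  have "0 \<le> KL_divergence (exp 1) M \<nu>"
    unfolding \<nu>_def
  proof (rule KL_nonneg)
    show "integrable M (\<lambda>x. exp (\<phi> x - L) * log (exp 1) (exp (\<phi> x - L)))"
    proof (intro integrable_const_bound[where B="exp (B - L) * (B + \<bar>L\<bar>)"] AE_I2)
      fix x
      show "norm (exp (\<phi> x - L) * log (exp 1) (exp (\<phi> x - L))) \<le> exp (B - L) * (B + \<bar>L\<bar>)"
        using bounded[of x] unfolding real_norm_def abs_mult
        by (intro mult_mono) (auto simp: log_def)
    qed measurable
  qed (use prob_\<nu> in \<open>auto simp: \<nu>_def\<close>)
  then show "L \<le> integral\<^sup>L \<nu> \<phi>"
    by (simp add: KL)
qed

text \<open>Bobkov--Goetze argument. With \<open>u\<close> the gap of the means of \<open>f\<close>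
  under \<nu> and \<mu>, and \<open>H\<close> the entropy of the tilted measure \<nu>, the
  log-Laplace transform equals \<open>l * integral\<^sup>L \<mu> f + (l * u - H)\<close>. Duality
  and \<open>T1\<close> give \<open>u \<le> sqrt (C * H)\<close>.\<close>

lemma T1_exp_moment_bounded:
  fixes \<mu> :: "'a::polish_space measure"
  assumes T1: "T1 C \<mu>" and "C \<ge> 0" and "l \<ge> 0"
    and f: "1-lipschitz_on UNIV f" and bounded: "\<And>x. \<bar>f x\<bar> \<le> B"
  shows "(\<integral>\<^sup>+ x. exp (l * f x) \<partial>\<mu>) \<le> ennreal (exp (l * integral\<^sup>L \<mu> f + l\<^sup>2 * C / 4))"
proof -
  from T1 have \<mu>1: "\<mu> \<in> prob_measures_1" by (simp add: T1_def)
  then have \<mu>: "\<mu> \<in> prob_measures" by (simp add: prob_measures_1_def)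
  note sets_\<mu> [measurable_cong] = prob_measuresD(2)[OF \<mu>]
  interpret prob_space \<mu> by (rule prob_measuresD[OF \<mu>])
  have f_meas [measurable]: "f \<in> borel_measurable borel" by (rule lipschitz_measurable[OF f])
  define \<phi> where "\<phi> x = l * f x" for x
  have [measurable]: "\<phi> \<in> borel_measurable borel" unfolding \<phi>_def by measurable
  have \<phi>: "\<phi> \<in> borel_measurable \<mu>" by measurable
  have \<phi>_bounded: "\<bar>\<phi> x\<bar> \<le> l * B" for x
    using bounded[of x] \<open>l \<ge> 0\<close> by (simp add: \<phi>_def abs_mult mult_left_mono)
  then have \<phi>_bnds: "- (l * B) \<le> \<phi> x" "\<phi> x \<le> l * B" for x
    by (simp_all add: abs_le_iff minus_le_iff)
  define L where "L = ln (expectation (\<lambda>x. exp (\<phi> x)))"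
  define \<nu> where "\<nu> = density \<mu> (\<lambda>x. ennreal (exp (\<phi> x - L)))"
  note tilt = relative_entropy_exp_tilt[OF \<phi> \<phi>_bounded, folded L_def, folded \<nu>_def]
  interpret \<nu>: prob_space \<nu> by (rule tilt(1))
  have [measurable_cong]: "sets \<nu> = sets borel" by (simp add: \<nu>_def sets_\<mu>)
  \<comment> \<open>\<open>T1\<close> speaks only of measures with finite first moment; \<nu> has
    one because its density is bounded.\<close>
  have "integrable \<nu> (dist undefined)"
  proof -
    have [measurable]: "dist undefined \<in> borel_measurable (borel :: 'a measure)"
      by (intro borel_measurable_continuous_onI continuous_intros)
    have int: "integrable \<mu> (\<lambda>x. exp (\<phi> x - L) *\<^sub>R dist undefined x)"
    proof (rule Bochner_Integration.integrable_bound)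
      show "integrable \<mu> (\<lambda>x. exp (l * B - L) * dist undefined x)"
        using prob_measures_1_integrable_dist[OF \<mu>1] by simp
      have "exp (\<phi> x - L) * dist undefined x \<le> exp (l * B - L) * dist undefined x" for x
        using \<phi>_bounded[of x] by (intro mult_right_mono) auto
      then show "AE x in \<mu>. norm (exp (\<phi> x - L) *\<^sub>R dist undefined x) \<le> norm (exp (l * B - L) * dist undefined x)"
        by simp
    qed measurable
    then show ?thesis
      unfolding \<nu>_def by (subst integrable_density) auto
  qed
  then have "\<nu> \<in> prob_measures_1"
    using tilt(1) by (auto simp: prob_measures_1_def prob_measures_def \<nu>_def sets_\<mu>)
  define u where "u = integral\<^sup>L \<nu> f - integral\<^sup>L \<mu> f"
  define H where "H = integral\<^sup>L \<nu> \<phi> - L"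
  have "H \<ge> 0" using tilt(3) by (simp add: H_def)
  have "ennreal u \<le> W1 \<mu> \<nu>"
    unfolding u_def by (rule W1_ge_bounded_lipschitz[OF f bounded])
  also have "\<dots> \<le> ereal_sqrt (ereal C * relative_entropy \<nu> \<mu>)"
    using T1 \<open>\<nu> \<in> prob_measures_1\<close> by (auto simp: T1_def)
  also have "\<dots> = ennreal (sqrt (C * H))"
    by (simp add: tilt(2) ereal_sqrt_def H_def)
  finally have "u \<le> sqrt (C * H)"
    using \<open>C \<ge> 0\<close> \<open>H \<ge> 0\<close> by (simp add: ennreal_le_iff)
  then have "l * u \<le> l * sqrt C * sqrt H"
    using \<open>l \<ge> 0\<close> by (simp add: real_sqrt_mult mult_left_mono mult.assoc)
  \<comment> \<open>Completing the square in \<open>sqrt H\<close> bounds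
    \<open>l * sqrt C * sqrt H - H\<close> by \<open>l\<^sup>2 * C / 4\<close>.\<close>
  moreover have "0 \<le> (sqrt H - l * sqrt C / 2)\<^sup>2"
    by simp
  moreover have "(sqrt H - l * sqrt C / 2)\<^sup>2 = H - l * sqrt C * sqrt H + l\<^sup>2 * C / 4"
    using \<open>C \<ge> 0\<close> \<open>H \<ge> 0\<close> by (simp add: power2_diff power_mult_distrib power_divide)
  ultimately have *: "l * u - H \<le> l\<^sup>2 * C / 4"
    by linarith
  have int_f: "integrable \<nu> f"
    using bounded by (intro \<nu>.integrable_const_bound[where B=B]) auto
  have "L = l * integral\<^sup>L \<mu> f + (l * u - H)"
    using int_f by (simp add: H_def u_def \<phi>_def[abs_def] algebra_simps)
  then have "L \<le> l * integral\<^sup>L \<mu> f + l\<^sup>2 * C / 4"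
    using * by simp
  moreover have int: "integrable \<mu> (\<lambda>x. exp (\<phi> x))"
    using \<phi>_bnds by (intro integrable_const_bound[where B="exp (l * B)"]) auto
  have "expectation (\<lambda>x. exp (- (l * B))) \<le> expectation (\<lambda>x. exp (\<phi> x))"
    using int \<phi>_bnds by (intro integral_mono) auto
  then have "exp L = expectation (\<lambda>x. exp (\<phi> x))"
    unfolding L_def using less_le_trans[OF exp_gt_zero[of "- (l * B)"]] by (intro exp_ln) (simp add: prob_space)
  ultimately have "expectation (\<lambda>x. exp (\<phi> x)) \<le> exp (l * integral\<^sup>L \<mu> f + l\<^sup>2 * C / 4)"
    by (metis exp_le_cancel_iff)
  then show ?thesis
    using int by (simp add: nn_integral_eq_integral \<phi>_def ennreal_leI)
qed

text \<open>Truncation at levels \<open>- m\<close> and \<open>m\<close> preserves the Lipschitz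
  constant and reduces to the bounded case. Fatou's lemma handles the exponential moments, dominated
  convergence the means.\<close>

lemma T1_exp_moment:
  fixes \<mu> :: "'a::polish_space measure"
  assumes T1: "T1 C \<mu>" and "C \<ge> 0" and "l \<ge> 0" and f: "1-lipschitz_on UNIV f"
  shows "(\<integral>\<^sup>+ x. exp (l * f x) \<partial>\<mu>) \<le> ennreal (exp (l * integral\<^sup>L \<mu> f + l\<^sup>2 * C / 4))"
proof -
  from T1 have \<mu>1: "\<mu> \<in> prob_measures_1" by (simp add: T1_def)
  then have \<mu>: "\<mu> \<in> prob_measures" by (simp add: prob_measures_1_def)
  note sets_\<mu> [measurable_cong] = prob_measuresD(2)[OF \<mu>]
  interpret prob_space \<mu> by (rule prob_measuresD[OF \<mu>])
  have [measurable]: "f \<in> borel_measurable borel" by (rule lipschitz_measurable[OF f])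
  define F where "F m x = max (- real m) (min (real m) (f x))" for m x
  have F_lim: "(\<lambda>m. F m x) \<longlonglongrightarrow> f x" for x
  proof (rule tendsto_eventually)
    obtain N where "\<bar>f x\<bar> \<le> real N" using real_arch_simple by blast
    then show "\<forall>\<^sub>F m in sequentially. F m x = f x"
      by (intro eventually_sequentiallyI[of N]) (auto simp: F_def)
  qed
  have F_lip: "1-lipschitz_on UNIV (F m)" for m
    using lipschitz_1D[OF f] by (intro lipschitz_1I) (smt (verit) F_def UNIV_I zero_le_dist)
  have [measurable]: "F m \<in> borel_measurable borel" for m by (rule lipschitz_measurable[OF F_lip])
  have int_lim: "(\<lambda>m. integral\<^sup>L \<mu> (F m)) \<longlonglongrightarrow> integral\<^sup>L \<mu> f"
  proof (rule integral_dominated_convergence[where w="\<lambda>x. \<bar>f x\<bar>"])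
    show "integrable \<mu> (\<lambda>x. \<bar>f x\<bar>)" using lipschitz_integrable[OF \<mu>1 f] by simp
    show "AE x in \<mu>. (\<lambda>m. F m x) \<longlonglongrightarrow> f x" using F_lim by simp
  qed (auto simp: F_def)
  have "(\<integral>\<^sup>+ x. exp (l * f x) \<partial>\<mu>) = (\<integral>\<^sup>+ x. liminf (\<lambda>m. ennreal (exp (l * F m x))) \<partial>\<mu>)"
    by (intro nn_integral_cong lim_imp_Liminf[symmetric] tendsto_ennrealI tendsto_intros F_lim) auto
  also have "\<dots> \<le> liminf (\<lambda>m. \<integral>\<^sup>+ x. ennreal (exp (l * F m x)) \<partial>\<mu>)"
    by (intro nn_integral_liminf) measurable
  also have "\<dots> \<le> liminf (\<lambda>m. ennreal (exp (l * integral\<^sup>L \<mu> (F m) + l\<^sup>2 * C / 4)))"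
  proof (intro Liminf_mono always_eventually allI)
    fix m
    have "\<bar>F m x\<bar> \<le> real m" for x by (auto simp: F_def)
    then show "(\<integral>\<^sup>+ x. exp (l * F m x) \<partial>\<mu>) \<le> ennreal (exp (l * integral\<^sup>L \<mu> (F m) + l\<^sup>2 * C / 4))"
      by (rule T1_exp_moment_bounded[OF assms(1-3) F_lip])
  qed
  also have "\<dots> = ennreal (exp (l * integral\<^sup>L \<mu> f + l\<^sup>2 * C / 4))"
    by (intro lim_imp_Liminf tendsto_ennrealI tendsto_intros int_lim) auto
  finally show ?thesis .
qed

section \<open>Chernoff bound for empirical averages\<close>

lemma T1_deviation:
  fixes \<mu> :: "'a::polish_space measure" and X :: "nat \<Rightarrow> 'b \<Rightarrow> 'a"
  assumes T1: "T1 C \<mu>" and "C > 0" and "r > 0" and "n \<ge> 1"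
    and M: "prob_space M" and indep: "prob_space.indep_vars M (\<lambda>_. borel) X {1..n}"
    and distr: "\<And>i. i \<in> {1..n} \<Longrightarrow> distr M borel (X i) = \<mu>"
    and f: "1-lipschitz_on UNIV f"
  shows "measure M {\<omega> \<in> space M. (\<Sum>i=1..n. f (X i \<omega>)) / n \<ge> integral\<^sup>L \<mu> f + r} \<le> exp (- (n * r\<^sup>2 / C))"
proof -
  interpret prob_space M by (rule M)
  have [measurable]: "f \<in> borel_measurable borel" by (rule lipschitz_measurable[OF f])
  have X_meas [measurable]: "X i \<in> borel_measurable M" if "i \<in> {1..n}" for i
    using indep that by (auto simp: indep_vars_def)
  \<comment> \<open>The minimiser of the Chernoff exponent
    \<open>- s * r + s\<^sup>2 * C / 4\<close>, with minimum \<open>- r\<^sup>2 / C\<close>.\<close>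
  define s where "s = 2 * r / C"
  have "s > 0" using assms by (simp add: s_def)
  define m where "m = integral\<^sup>L \<mu> f"
  have "n > 0" using \<open>n \<ge> 1\<close> by simp
  have "(\<integral>\<^sup>+ \<omega>. ennreal (exp (s * (\<Sum>i=1..n. f (X i \<omega>)))) \<partial>M) =
      (\<integral>\<^sup>+ \<omega>. (\<Prod>i=1..n. ennreal (exp (s * f (X i \<omega>)))) \<partial>M)"
    by (simp add: prod_ennreal exp_sum sum_distrib_left)
  also have "\<dots> = (\<Prod>i=1..n. \<integral>\<^sup>+ \<omega>. ennreal (exp (s * f (X i \<omega>))) \<partial>M)"
    by (intro indep_vars_nn_integral indep_vars_compose2[OF indep, where Y="\<lambda>_ x. ennreal (exp (s * f x))"]) auto
  also have "\<dots> \<le> (\<Prod>i=1..n. ennreal (exp (s * m + s\<^sup>2 * C / 4)))"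
  proof (rule prod_mono_ennreal)
    fix i assume i: "i \<in> {1..n}"
    have "(\<integral>\<^sup>+ \<omega>. ennreal (exp (s * f (X i \<omega>))) \<partial>M) = (\<integral>\<^sup>+ x. exp (s * f x) \<partial>\<mu>)"
      unfolding distr[OF i, symmetric] using X_meas[OF i] by (subst nn_integral_distr) auto
    then show "(\<integral>\<^sup>+ \<omega>. ennreal (exp (s * f (X i \<omega>))) \<partial>M) \<le> ennreal (exp (s * m + s\<^sup>2 * C / 4))"
      using T1_exp_moment[OF T1 _ _ f, of s] \<open>C > 0\<close> \<open>s > 0\<close> by (simp add: m_def)
  qed
  also have "\<dots> = ennreal (exp (n * (s * m + s\<^sup>2 * C / 4)))"
    by (simp add: exp_of_nat_mult ennreal_power)
  finally have mgf: "(\<integral>\<^sup>+ \<omega>. ennreal (exp (s * (\<Sum>i=1..n. f (X i \<omega>)))) \<partial>M) \<le> \<dots>" .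
  have sum_meas [measurable]: "(\<lambda>\<omega>. \<Sum>i=1..n. f (X i \<omega>)) \<in> borel_measurable M"
    by (intro borel_measurable_sum) measurable
  have "emeasure M {\<omega> \<in> space M. (\<Sum>i=1..n. f (X i \<omega>)) \<ge> n * (m + r)} \<le>
      ennreal (exp (- s * (n * (m + r)))) * (\<integral>\<^sup>+ \<omega>. ennreal (exp (s * (\<Sum>i=1..n. f (X i \<omega>)))) * indicator (space M) \<omega> \<partial>M)"
    using \<open>s > 0\<close> by (intro Chernoff_ineq_nn_integral_ge) auto
  also have "\<dots> = ennreal (exp (- s * (n * (m + r)))) * (\<integral>\<^sup>+ \<omega>. ennreal (exp (s * (\<Sum>i=1..n. f (X i \<omega>)))) \<partial>M)"
    by (intro arg_cong2[where f="(*)"] nn_integral_cong) auto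
  also have "\<dots> \<le> ennreal (exp (- s * (n * (m + r)))) * ennreal (exp (n * (s * m + s\<^sup>2 * C / 4)))"
    by (intro mult_left_mono mgf) auto
  also have "\<dots> = ennreal (exp (- s * (n * (m + r)) + n * (s * m + s\<^sup>2 * C / 4)))"
    unfolding exp_add by (rule ennreal_mult[symmetric]) auto
  also have "- s * (n * (m + r)) + n * (s * m + s\<^sup>2 * C / 4) = - (n * r\<^sup>2 / C)"
    using \<open>C > 0\<close> by (simp add: s_def power2_eq_square field_simps)
  finally have "measure M {\<omega> \<in> space M. (\<Sum>i=1..n. f (X i \<omega>)) \<ge> n * (m + r)} \<le> exp (- (n * r\<^sup>2 / C))"
    by (simp add: emeasure_eq_measure)
  moreover have "n * (m + r) \<le> S \<longleftrightarrow> m + r \<le> S / n" for S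
    using \<open>n > 0\<close> by (simp add: field_simps)
  ultimately show ?thesis
    by (simp add: m_def)
qed

subsection \<open>Lipschitz functions on a compact set\<close>

text \<open>The lower McShane extension, the smallest 1-Lipschitz extension of a 1-Lipschitz
  function on \<open>K\<close>.\<close>

definition lower_lipschitz_extension :: "'a::metric_space set \<Rightarrow> ('a \<Rightarrow> real) \<Rightarrow> 'a \<Rightarrow> real"
  where "lower_lipschitz_extension K f x = (SUP k\<in>K. f k - dist x k)"

context
  fixes K :: "'a::metric_space set" and f :: "'a \<Rightarrow> real"
  assumes ne: "K \<noteq> {}" and f: "1-lipschitz_on K f"
begin

lemma bdd_above_lower_lipschitz_extension: "bdd_above ((\<lambda>k. f k - dist x k) ` K)"
proof -
  obtain k0 where k0: "k0 \<in> K" using ne by blast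
  have "f k - dist x k \<le> f k0 + dist x k0" if "k \<in> K" for k
    using lipschitz_1D[OF f that k0] dist_triangle[of k k0 x] by (simp add: dist_commute)
  then show ?thesis by (intro bdd_aboveI2)
qed

lemma lower_lipschitz_extension_ge:
  "k \<in> K \<Longrightarrow> f k - dist x k \<le> lower_lipschitz_extension K f x"
  unfolding lower_lipschitz_extension_def
  by (intro cSUP_upper bdd_above_lower_lipschitz_extension)

lemma lipschitz_on_lower_lipschitz_extension: "1-lipschitz_on UNIV (lower_lipschitz_extension K f)"
proof (rule lipschitz_1I)
  fix x y
  have "f k - dist x k \<le> lower_lipschitz_extension K f y + dist x y" if "k \<in> K" for k
    using lower_lipschitz_extension_ge[OF that, of y] dist_triangle[of y k x] by (simp add: dist_commute)
  then show "lower_lipschitz_extension K f x \<le> lower_lipschitz_extension K f y + dist x y"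
    unfolding lower_lipschitz_extension_def[of K f x] by (intro cSUP_least ne)
qed

text \<open>\<open>f k - dist x k \<le> g k + \<delta> - dist x k \<le> g x + \<delta>\<close>. A
  one-sided comparison on \<open>K\<close> thus spreads to the whole space without loss, which later
  controls sample points outside \<open>K\<close>.\<close>

lemma lower_lipschitz_extension_minimal:
  assumes g: "1-lipschitz_on UNIV g" and le: "\<And>k. k \<in> K \<Longrightarrow> f k \<le> g k + \<delta>"
  shows "lower_lipschitz_extension K f x \<le> g x + \<delta>"
  unfolding lower_lipschitz_extension_def
proof (rule cSUP_least[OF ne])
  fix k assume "k \<in> K"
  then show "f k - dist x k \<le> g x + \<delta>"
    using le[of k] lipschitz_1D[OF g, of k x] by (simp add: dist_commute)
qed

end

section \<open>Finite covers of the Lipschitz space\<close>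

lemma mdist_lipschitz_space_le_iff:
  assumes "compact K" "K \<noteq> {}" "f \<in> mspace (lipschitz_space K x0)" "g \<in> mspace (lipschitz_space K x0)"
  shows "mdist (lipschitz_space K x0) f g \<le> \<delta> \<longleftrightarrow> (\<forall>x\<in>K. \<bar>f x - g x\<bar> \<le> \<delta>)"
proof -
  have fg: "f \<in> Met_TC.fspace K" "g \<in> Met_TC.fspace K"
    using assms(3,4) by (auto simp: lipschitz_space_def)
  have "mdist (lipschitz_space K x0) f g = (SUP x\<in>K. dist (f x) (g x))"
    using fg \<open>K \<noteq> {}\<close> by (simp add: lipschitz_space_def Met_TC.fdist_def)
  then show ?thesis
    using Met_TC.bdd_above_dist[OF fg \<open>K \<noteq> {}\<close>] \<open>K \<noteq> {}\<close>
    by (simp add: cSUP_le_iff dist_real_def)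
qed

text \<open>Total boundedness by discretisation: values on a finite \<epsilon>-net are rounded down
  to multiples of \<epsilon>. Since \<open>\<bar>f x\<bar> \<le> dist x0 x\<close>, finitely many
  patterns occur, and functions sharing a pattern are uniformly close.\<close>

lemma lipschitz_space_finite_cover:
  assumes "compact K" "x0 \<in> K" "\<delta> > 0"
  shows "\<exists>S. S \<subseteq> mspace (lipschitz_space K x0) \<and> finite S \<and>
    mspace (lipschitz_space K x0) \<subseteq> (\<Union>c\<in>S. mcball_of (lipschitz_space K x0) c \<delta>)"
proof -
  let ?A = "mspace (lipschitz_space K x0)"
  have A: "f \<in> ?A \<longleftrightarrow> f \<in> extensional K \<and> 1-lipschitz_on K f \<and> f x0 = 0" for f
    using mspace_lipschitz_space[OF \<open>compact K\<close>] by blast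
  \<comment> \<open>The distance of two functions with equal pattern is split into three errors
    below \<epsilon>: two for moving to a net point and one for the rounding.\<close>
  define \<epsilon> where "\<epsilon> = \<delta> / 4"
  have \<epsilon>: "\<epsilon> > 0" using \<open>\<delta> > 0\<close> by (simp add: \<epsilon>_def)
  obtain T where T: "finite T" "T \<subseteq> K" "K \<subseteq> (\<Union>x\<in>T. ball x \<epsilon>)"
    by (rule compactE_image[OF \<open>compact K\<close>, of K "\<lambda>x. ball x \<epsilon>"]) (use \<epsilon> in auto)
  define \<Psi> where "\<Psi> f = (\<lambda>x\<in>T. \<lfloor>f x / \<epsilon>\<rfloor>)" for f :: "'a \<Rightarrow> real"
  have "\<Psi> ` ?A \<subseteq> (\<Pi>\<^sub>E x\<in>T. {\<lfloor>- dist x0 x / \<epsilon>\<rfloor> .. \<lfloor>dist x0 x / \<epsilon>\<rfloor>})"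
  proof (safe intro!: PiE_I)
    fix f x assume "f \<in> ?A" "x \<in> T"
    then have "f x \<le> dist x0 x" "- dist x0 x \<le> f x"
      using lipschitz_1D[of K f x x0] lipschitz_1D[of K f x0 x] T(2) \<open>x0 \<in> K\<close>
      by (auto simp: A dist_commute)
    then have "- dist x0 x / \<epsilon> \<le> f x / \<epsilon>" "f x / \<epsilon> \<le> dist x0 x / \<epsilon>"
      using \<epsilon> by (simp_all only: divide_right_mono less_imp_le)
    then show "\<Psi> f x \<in> {\<lfloor>- dist x0 x / \<epsilon>\<rfloor> .. \<lfloor>dist x0 x / \<epsilon>\<rfloor>}"
      unfolding \<Psi>_def restrict_apply'[OF \<open>x \<in> T\<close>] atLeastAtMost_iff by (intro conjI floor_mono)
  qed (simp add: \<Psi>_def)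
  then have "finite (\<Psi> ` ?A)"
    by (rule finite_subset) (auto intro: finite_PiE T)
  \<comment> \<open>One representative per pattern, so that the centers lie in the space
    itself.\<close>
  moreover obtain S where S: "S \<subseteq> ?A" "inj_on \<Psi> S" "\<Psi> ` ?A = \<Psi> ` S"
    using subset_image_inj[of "\<Psi> ` ?A" \<Psi> ?A] by auto
  ultimately have "finite S"
    by (metis finite_imageD)
  moreover have "g \<in> (\<Union>c\<in>S. mcball_of (lipschitz_space K x0) c \<delta>)" if g: "g \<in> ?A" for g
  proof -
    obtain f where f: "f \<in> S" "\<Psi> g = \<Psi> f"
      using S(3) g by blast
    with S(1) have fA: "f \<in> ?A" by blast
    have "\<bar>f x - g x\<bar> \<le> \<delta>" if x: "x \<in> K" for x
    proof -
      obtain y where y: "y \<in> T" "dist y x < \<epsilon>" using T(3) x by auto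
      then have "y \<in> K" using T(2) by blast
      have "\<lfloor>f y / \<epsilon>\<rfloor> = \<lfloor>g y / \<epsilon>\<rfloor>"
        using fun_cong[OF f(2), of y] y(1) by (simp add: \<Psi>_def)
      then have "\<bar>f y / \<epsilon> - g y / \<epsilon>\<bar> < 1" by linarith
      then have "\<bar>f y - g y\<bar> < \<epsilon>"
        using \<epsilon> by (simp flip: diff_divide_distrib)
      moreover have "\<bar>f x - f y\<bar> < \<epsilon>" "\<bar>g x - g y\<bar> < \<epsilon>"
        using fA g x \<open>y \<in> K\<close> y(2) lipschitz_1D[of K _ x y] lipschitz_1D[of K _ y x]
        unfolding A by (smt (verit, best) dist_commute)+
      ultimately show ?thesis
        unfolding \<epsilon>_def by linarith
    qed
    then have "mdist (lipschitz_space K x0) f g \<le> \<delta>"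
      using mdist_lipschitz_space_le_iff[OF \<open>compact K\<close> _ fA g] \<open>x0 \<in> K\<close> by blast
    then show ?thesis
      using f(1) fA g by auto
  qed
  ultimately show ?thesis
    using S(1) by blast
qed

text \<open>The existence of a finite cover ensures that the \<open>LEAST\<close> in the covering
  number is attained by an actual cover.\<close>

lemma covering_number_lipschitz_space:
  assumes "compact K" "x0 \<in> K" "\<delta> > 0"
  obtains S where "S \<subseteq> mspace (lipschitz_space K x0)" "finite S"
    "card S = covering_number (lipschitz_space K x0) \<delta>"
    "\<And>g. g \<in> mspace (lipschitz_space K x0) \<Longrightarrow> \<exists>f\<in>S. \<forall>x\<in>K. \<bar>f x - g x\<bar> \<le> \<delta>"
proof -
  let ?A = "lipschitz_space K x0"
  let ?P = "\<lambda>N. \<exists>S. S \<subseteq> mspace ?A \<and> finite S \<and> card S = N \<and> mspace ?A \<subseteq> (\<Union>c\<in>S. mcball_of ?A c \<delta>)"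
  have "\<exists>N. ?P N"
    using lipschitz_space_finite_cover[OF assms] by blast
  then have "?P (covering_number ?A \<delta>)"
    unfolding covering_number_def by (rule LeastI_ex)
  then obtain S where S: "S \<subseteq> mspace ?A" "finite S" "card S = covering_number ?A \<delta>"
      "mspace ?A \<subseteq> (\<Union>c\<in>S. mcball_of ?A c \<delta>)"
    by blast
  have "\<exists>f\<in>S. \<forall>x\<in>K. \<bar>f x - g x\<bar> \<le> \<delta>" if g: "g \<in> mspace ?A" for g
  proof -
    obtain f where f: "f \<in> S" "g \<in> mcball_of ?A f \<delta>"
      using S(4) g by blast
    then have "mdist ?A f g \<le> \<delta>" "f \<in> mspace ?A" by auto
    then show ?thesis
      using mdist_lipschitz_space_le_iff[OF \<open>compact K\<close> _ _ g] \<open>x0 \<in> K\<close> f(1) by blast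
  qed
  then show ?thesis
    using that S(1-3) by blast
qed

subsection \<open>Tail bound and conclusion\<close>

text \<open>Young's inequality: \<open>s * ln s - s + 1\<close> is the Legendre transform of
  \<open>exp y - 1\<close> at \<open>s\<close>. It is \<open>exp z \<ge> 1 + z\<close> at
  \<open>z = y - ln s\<close>, multiplied by \<open>s\<close>.\<close>

lemma mult_le_exp_add_entropy:
  fixes s y :: real
  assumes "s > 0"
  shows "s * y \<le> (s * ln s - s + 1) + (exp y - 1)"
proof -
  have "s * (1 + (y - ln s)) \<le> s * exp (y - ln s)"
    using assms by (intro mult_left_mono exp_ge_add_one_self) auto
  also have "\<dots> = exp y"
    using assms by (simp add: exp_diff)
  finally show ?thesis
    by (simp add: algebra_simps)
qed

text \<open>Young's inequality on \<open>A\<close> bounds \<open>s\<close> times the tail by two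
  terms: the entropy constant times the mass of \<open>A\<close>, and the mean of
  \<open>exp \<phi> - 1\<close>. Each is at most 1.\<close>

lemma (in prob_space) exp_moment_tail_bound:
  fixes \<phi> :: "'a \<Rightarrow> real"
  assumes [measurable]: "\<phi> \<in> borel_measurable M" "A \<in> sets M" and nonneg: "\<And>x. \<phi> x \<ge> 0"
    and moment: "(\<integral>\<^sup>+ x. ennreal (exp (\<phi> x)) \<partial>M) \<le> 2" and "s > 0"
    and A: "emeasure M A \<le> inverse (ennreal (s * ln s - s + 1))"
  shows "expectation (\<lambda>x. \<phi> x * indicator A x) \<le> 2 / s"
proof -
  define \<tau> where "\<tau> = s * ln s - s + 1"
  have "\<tau> \<ge> 0"
    using mult_le_exp_add_entropy[OF \<open>s > 0\<close>, of 0] by (simp add: \<tau>_def)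
  \<comment> \<open>For \<open>\<tau> = 0\<close> the inverse is infinite and says nothing about
    \<open>A\<close>, but then the product is 0.\<close>
  have \<tau>_A: "\<tau> * measure M A \<le> 1"
  proof (cases "\<tau> = 0")
    case False
    with \<open>\<tau> \<ge> 0\<close> have "\<tau> > 0" by simp
    then have "ennreal (measure M A) \<le> ennreal (inverse \<tau>)"
      using A by (simp add: \<tau>_def[symmetric] emeasure_eq_measure inverse_ennreal)
    then show ?thesis
      using \<open>\<tau> > 0\<close> by (simp add: field_simps)
  qed simp
  have int_exp: "integrable M (\<lambda>x. exp (\<phi> x))"
    using moment by (intro integrableI_nonneg) (auto intro: le_less_trans)
  then have exp_le: "expectation (\<lambda>x. exp (\<phi> x)) \<le> 2"
    using moment ennreal_le_iff[of 2] by (simp add: nn_integral_eq_integral)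
  have int_\<phi>: "integrable M (\<lambda>x. \<phi> x * indicator A x)"
  proof (rule Bochner_Integration.integrable_bound[OF int_exp])
    have "\<phi> x \<le> exp (\<phi> x)" for x
      using exp_ge_add_one_self[of "\<phi> x"] by linarith
    then show "AE x in M. norm (\<phi> x * indicator A x) \<le> norm (exp (\<phi> x))"
      using nonneg by (auto simp: indicator_def)
  qed measurable
  have int_A: "integrable M (\<lambda>x. \<tau> * indicator A x)"
    by (intro integrable_mult_right integrable_real_indicator) (auto simp: less_top[symmetric])
  have "s * expectation (\<lambda>x. \<phi> x * indicator A x) = expectation (\<lambda>x. s * (\<phi> x * indicator A x))"
    by simp
  also have "\<dots> \<le> expectation (\<lambda>x. \<tau> * indicator A x + (exp (\<phi> x) - 1))"
  proof (rule integral_mono[OF integrable_mult_right[OF int_\<phi>] Bochner_Integration.integrable_add[OF int_A]])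
    fix x
    show "s * (\<phi> x * indicator A x) \<le> \<tau> * indicator A x + (exp (\<phi> x) - 1)"
      using mult_le_exp_add_entropy[OF \<open>s > 0\<close>, of "\<phi> x"] nonneg[of x]
      by (auto simp: indicator_def \<tau>_def)
  qed (use int_exp in simp)
  also have "\<dots> = \<tau> * measure M A + (expectation (\<lambda>x. exp (\<phi> x)) - 1)"
    using int_exp int_A by (subst Bochner_Integration.integral_add) (auto simp: prob_space)
  also have "\<dots> \<le> 2"
    using \<tau>_A exp_le by simp
  finally show ?thesis
    using \<open>s > 0\<close> by (simp add: field_simps)
qed

theorem corollary2p3:
  fixes \<mu> :: "'a::polish_space measure"
    and M :: "'b measure"
    and X :: "nat \<Rightarrow> 'b \<Rightarrow> 'a"
    and K :: "'a set"
    and x0 :: 'a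
    and C t a :: real
    and n :: nat
  assumes "C > 0" and "t > 0" and "a > 0" and "n \<ge> 1"
    and "\<mu> \<in> prob_measures"
    and "T1 C \<mu>"
    and "prob_space M"
    and "prob_space.indep_vars M (\<lambda>_. borel) X {1..n}"
    and "\<forall>i\<in>{1..n}. distr M borel (X i) = \<mu>"
    and "(\<integral>\<^sup>+ x. ennreal (exp (a * dist x0 x)) \<partial>\<mu>) \<le> 2"
    and "compact K" and "x0 \<in> K"
    and "emeasure \<mu> (- K) \<le>
      inverse (ennreal (32 / (a * t) * ln (32 / (a * t)) - 32 / (a * t) + 1))"
  shows "measure M {\<omega> \<in> space M. W1 (empirical_measure n (\<lambda>i. X i \<omega>)) \<mu> \<ge> ennreal t}
    \<le> real (covering_number (lipschitz_space K x0) (t / 8)) * exp (- (1 / (8 * C)) * real n * t\<^sup>2)"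
proof -
  interpret M: prob_space M by fact
  note sets_\<mu> [measurable_cong] = prob_measuresD(2)[OF \<open>\<mu> \<in> prob_measures\<close>]
  interpret \<mu>: prob_space \<mu> by (rule prob_measuresD) fact
  have \<mu>1: "\<mu> \<in> prob_measures_1" using \<open>T1 C \<mu>\<close> by (simp add: T1_def)
  have "K \<noteq> {}" using \<open>x0 \<in> K\<close> by blast
  have [measurable]: "K \<in> sets borel" using \<open>compact K\<close> by (simp add: borel_compact)
  have [measurable]: "dist x0 \<in> borel_measurable borel"
    by (intro borel_measurable_continuous_onI continuous_intros)
  have A: "f \<in> mspace (lipschitz_space K x0) \<longleftrightarrow> f \<in> extensional K \<and> 1-lipschitz_on K f \<and> f x0 = 0" for f
    using mspace_lipschitz_space[OF \<open>compact K\<close>] by blast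
  obtain S where S: "S \<subseteq> mspace (lipschitz_space K x0)" "finite S"
    "card S = covering_number (lipschitz_space K x0) (t / 8)"
    "\<And>g. g \<in> mspace (lipschitz_space K x0) \<Longrightarrow> \<exists>f\<in>S. \<forall>x\<in>K. \<bar>f x - g x\<bar> \<le> t / 8"
    using covering_number_lipschitz_space[OF \<open>compact K\<close> \<open>x0 \<in> K\<close>, of "t / 8"] \<open>t > 0\<close> by auto
  let ?F = "lower_lipschitz_extension K"
  have S_lip: "1-lipschitz_on K f" "f x0 = 0" if "f \<in> S" for f
    using S(1) that A by blast+
  have F_lip: "1-lipschitz_on UNIV (?F f)" if "f \<in> S" for f
    by (intro lipschitz_on_lower_lipschitz_extension \<open>K \<noteq> {}\<close> S_lip that)
  \<comment> \<open>The tail bound with \<open>s = 32 / (a * t)\<close> and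
    \<open>\<phi> = a * dist x0\<close> gives \<open>a * t / 16\<close>; then \<open>a\<close> is
    divided out.\<close>
  have tail: "\<mu>.expectation (\<lambda>x. dist x0 x * indicator (- K) x) \<le> t / 16"
  proof -
    have "\<mu>.expectation (\<lambda>x. a * dist x0 x * indicator (- K) x) \<le> 2 / (32 / (a * t))"
      using assms by (intro \<mu>.exp_moment_tail_bound) auto
    then show ?thesis
      using \<open>a > 0\<close> \<open>t > 0\<close> by (simp add: mult.assoc field_simps)
  qed
  have int_tail: "integrable \<mu> (\<lambda>x. dist x0 x * indicator (- K) x)"
    using prob_measures_1_integrable_dist[OF \<mu>1] by (intro integrable_real_mult_indicator) auto
  \<comment> \<open>The sign is reversed because the deviation bound concerns averages exceeding
    their mean. The level is \<open>t\<close> minus four errors of \<open>t / 8\<close>: duality,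
    the cover under \<mu>, the cover under the empirical measure, and the tail under \<mu>.\<close>
  define E where "E f = {\<omega> \<in> space M. (\<Sum>i=1..n. - ?F f (X i \<omega>)) / n \<ge> (\<integral>x. - ?F f x \<partial>\<mu>) + t / 2}" for f
  have cover: "{\<omega> \<in> space M. W1 (empirical_measure n (\<lambda>i. X i \<omega>)) \<mu> \<ge> ennreal t} \<subseteq> (\<Union>f\<in>S. E f)"
  proof safe
    fix \<omega> assume \<omega>: "\<omega> \<in> space M" and W: "ennreal t \<le> W1 (empirical_measure n (\<lambda>i. X i \<omega>)) \<mu>"
    define avg where "avg h = (\<Sum>i=1..n. h (X i \<omega>)) / n" for h :: "'a \<Rightarrow> real"
    have avg_add: "avg (\<lambda>x. h x + b) = avg h + b" for h b
      using \<open>n \<ge> 1\<close> by (simp add: avg_def sum.distrib field_simps)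
    obtain g0 where g0: "1-lipschitz_on UNIV g0"
        and "W1 (empirical_measure n (\<lambda>i. X i \<omega>)) \<mu> \<le> ennreal (integral\<^sup>L \<mu> g0 - avg g0 + t / 8)"
      using W1_empirical_approx_dual[OF \<mu>1 \<open>n \<ge> 1\<close>, of "t / 8" "\<lambda>i. X i \<omega>"] \<open>t > 0\<close>
      unfolding avg_def by auto
    then have "ennreal t \<le> ennreal (integral\<^sup>L \<mu> g0 - avg g0 + t / 8)"
      using W by (metis order_trans)
    \<comment> \<open>As \<open>t > 0\<close>, the right-hand side cannot be a negative number that
      \<open>ennreal\<close> sends to 0.\<close>
    then have t_le0: "t \<le> integral\<^sup>L \<mu> g0 - avg g0 + t / 8"
      using \<open>t > 0\<close> by (simp add: ennreal_le_iff2)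
    \<comment> \<open>Normalisation at \<open>x0\<close> puts \<open>g\<close> into the space that
      is covered; adding a constant does not change the dual functional.\<close>
    define g where "g x = g0 x + - g0 x0" for x
    have g: "1-lipschitz_on UNIV g" "g x0 = 0"
      using lipschitz_1D[OF g0] by (auto simp: g_def intro!: lipschitz_1I)
    have int_g: "integrable \<mu> g" by (rule lipschitz_integrable[OF \<mu>1 g(1)])
    have "integral\<^sup>L \<mu> g = integral\<^sup>L \<mu> g0 + - g0 x0"
      unfolding g_def[abs_def] using lipschitz_integrable[OF \<mu>1 g0] by (simp add: \<mu>.prob_space)
    moreover have "avg g = avg g0 + - g0 x0"
      unfolding g_def[abs_def] by (rule avg_add)
    ultimately have t_le: "t \<le> integral\<^sup>L \<mu> g - avg g + t / 8"
      using t_le0 by simp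
    have "restrict g K \<in> mspace (lipschitz_space K x0)"
      unfolding A using lipschitz_1D[OF g(1)] g(2) \<open>x0 \<in> K\<close> by (auto intro!: lipschitz_1I)
    then obtain f where f: "f \<in> S" "\<And>x. x \<in> K \<Longrightarrow> \<bar>f x - g x\<bar> \<le> t / 8"
      using S(4) by fastforce
    note lip_f = S_lip[OF f(1)]
    have lower: "?F f x \<le> g x + t / 8" for x
      by (rule lower_lipschitz_extension_minimal[OF \<open>K \<noteq> {}\<close> lip_f(1) g(1)]) (use f(2) in \<open>smt (verit)\<close>)
    \<comment> \<open>Off \<open>K\<close> both \<open>g\<close> and \<open>- ?F f\<close> are at
      most \<open>dist x0\<close>, which explains the factor 2.\<close>
    have upper: "g x \<le> ?F f x + t / 8 + 2 * (dist x0 x * indicator (- K) x)" for x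
    proof (cases "x \<in> K")
      case True
      have "f x \<le> ?F f x"
        using lower_lipschitz_extension_ge[OF \<open>K \<noteq> {}\<close> lip_f(1) True, of x] by simp
      then have "g x \<le> ?F f x + t / 8"
        using f(2)[OF True] by linarith
      then show ?thesis
        using True by simp
    next
      case False
      have "g x \<le> dist x0 x"
        using lipschitz_1D[OF g(1), of x x0] g(2) by (simp add: dist_commute)
      moreover have "- dist x0 x \<le> ?F f x"
        using lower_lipschitz_extension_ge[OF \<open>K \<noteq> {}\<close> lip_f(1) \<open>x0 \<in> K\<close>, of x] lip_f(2)
        by (simp add: dist_commute)
      ultimately show ?thesis
        using False \<open>t > 0\<close> by simp
    qed
    have int_F: "integrable \<mu> (?F f)" by (rule lipschitz_integrable[OF \<mu>1 F_lip[OF f(1)]])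
    have "integral\<^sup>L \<mu> g \<le> \<mu>.expectation (\<lambda>x. ?F f x + t / 8 + 2 * (dist x0 x * indicator (- K) x))"
      using int_g int_F int_tail upper by (intro integral_mono) auto
    also have "\<dots> = integral\<^sup>L \<mu> (?F f) + t / 8 + 2 * \<mu>.expectation (\<lambda>x. dist x0 x * indicator (- K) x)"
      using int_F int_tail by (simp add: \<mu>.prob_space)
    also have "\<dots> \<le> integral\<^sup>L \<mu> (?F f) + t / 8 + t / 8"
      using tail by simp
    finally have "integral\<^sup>L \<mu> g \<le> integral\<^sup>L \<mu> (?F f) + t / 8 + t / 8" .
    moreover have "avg (?F f) \<le> avg (\<lambda>x. g x + t / 8)"
      unfolding avg_def using lower by (intro divide_right_mono sum_mono) auto
    ultimately have "avg (?F f) + t / 2 \<le> integral\<^sup>L \<mu> (?F f)"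
      using t_le unfolding avg_add by linarith
    then have "\<omega> \<in> E f"
      using \<omega> by (simp add: E_def avg_def sum_negf)
    with f(1) show "\<omega> \<in> (\<Union>f\<in>S. E f)" by blast
  qed
  have E_sets: "E f \<in> sets M" if f: "f \<in> S" for f
  proof -
    have [measurable]: "?F f \<in> borel_measurable borel" by (rule lipschitz_measurable[OF F_lip[OF f]])
    have [measurable]: "X i \<in> borel_measurable M" if "i \<in> {1..n}" for i
      using assms(8) that by (auto simp: M.indep_vars_def)
    have [measurable]: "(\<lambda>\<omega>. \<Sum>i=1..n. - ?F f (X i \<omega>)) \<in> borel_measurable M"
      by (intro borel_measurable_sum) measurable
    show ?thesis unfolding E_def by measurable
  qed
  have E_le: "measure M (E f) \<le> exp (- (1 / (8 * C)) * real n * t\<^sup>2)" if f: "f \<in> S" for f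
  proof -
    have "1-lipschitz_on UNIV (\<lambda>x. - ?F f x)"
      using F_lip[OF f] by (simp add: lipschitz_on_def)
    then have "measure M (E f) \<le> exp (- (n * (t / 2)\<^sup>2 / C))"
      unfolding E_def using assms by (intro T1_deviation) auto
    \<comment> \<open>Deviation level \<open>t / 2\<close> gives the exponent
      \<open>n * t\<^sup>2 / (4 * C)\<close>, twice the one claimed.\<close>
    also have "\<dots> \<le> exp (- (1 / (8 * C)) * real n * t\<^sup>2)"
      using \<open>C > 0\<close> \<open>t > 0\<close> by (simp add: power2_eq_square field_simps)
    finally show ?thesis .
  qed
  \<comment> \<open>Monotonicity rests on measurability of the larger set, the finite union of the
    \<open>E f\<close>.\<close>
  have "measure M {\<omega> \<in> space M. W1 (empirical_measure n (\<lambda>i. X i \<omega>)) \<mu> \<ge> ennreal t} \<le> measure M (\<Union>f\<in>S. E f)"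
    using cover E_sets S(2) by (intro M.finite_measure_mono sets.finite_UN) auto
  also have "\<dots> \<le> (\<Sum>f\<in>S. measure M (E f))"
    using E_sets S(2) by (intro M.finite_measure_subadditive_finite) auto
  also have "\<dots> \<le> (\<Sum>f\<in>S. exp (- (1 / (8 * C)) * real n * t\<^sup>2))"
    by (intro sum_mono E_le)
  finally show ?thesis
    by (simp add: S(3))
qed

end
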